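(* Let $L$ be a countable linear order of Hausdorff rank $1$. Then $L$ has a computable $d$-$\Sigma_3$ Scott sentence.
   Context: Infinitary formulas of $L_{\omega_1\omega}$: $\Sigma_0=\Pi_0$ are finitary quantifier-free formulas; for $\alpha>0$, $\Sigma_\alpha$ formulas are countable disjunctions $\bigvee_i\exists\bar x\,\varphi_i$ with $\varphi_i$ $\Pi_\beta$, $\beta<\alpha$; $\Pi_\alpha$ formulas are countable conjunctions $\bigwedge_i\forall\bar x\,\varphi_i$ with $\varphi_i$ $\Sigma_\beta$, $\beta<\alpha$; $d$-$\Sigma_\alpha$ formulas are conjunctions of a $\Sigma_\alpha$ and a $\Pi_\alpha$ formula. A formula is computable if all its infinitary disjunctions and conjunctions are over c.e. sets of formulas. A Scott sentence of a countable structure $\mathcal A$ is an $L_{\omega_1\omega}$ sentence true in exactly the countable structures isomorphic to $\mathcal A$. Hausdorff rank: $HR_0$ = finite linear orders (including empty); for $\alpha>0$, $HR_\alpha$ is the least class containing all $\sum_{i\in\zeta}L_i$ with $L_i\in\bigcup_{\beta<\alpha}HR_\beta$ and closed under finite sums; the Hausdorff rank $r(L)$ is the least $\alpha$ with $L\in HR_\alpha$. *)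

theory Defs
  imports "HOL-Library.Countable_Set_Type" "HOL-Library.Nat_Bijection"
begin

section \<open>Infinitary formulas in the language of orders\<close>

text \<open>
  Formulas of the infinitary logic with countable conjunctions and disjunctions, in the language
  with one binary relation symbol (and equality). Variables are natural numbers. A structure for
  this language is a carrier \<open>A\<close>, which may be empty, together with a relation \<open>r \<subseteq> A \<times> A\<close>.
\<close>

datatype fm =
    Bot
  | Leq nat nat
  | Eql nat nat
  | Neg fm
  | And fm fm
  | Or fm fm
  | Exists nat fm
  | Forall nat fm
  | Disj "fm cset"
  | Conj "fm cset"

primrec sat :: "'a set \<Rightarrow> 'a rel \<Rightarrow> fm \<Rightarrow> (nat \<Rightarrow> 'a) \<Rightarrow> bool" where
  "sat A r Bot = (\<lambda>e. False)"
| "sat A r (Leq i j) = (\<lambda>e. (e i, e j) \<in> r)"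
| "sat A r (Eql i j) = (\<lambda>e. e i = e j)"
| "sat A r (Neg \<phi>) = (\<lambda>e. \<not> sat A r \<phi> e)"
| "sat A r (And \<phi> \<psi>) = (\<lambda>e. sat A r \<phi> e \<and> sat A r \<psi> e)"
| "sat A r (Or \<phi> \<psi>) = (\<lambda>e. sat A r \<phi> e \<or> sat A r \<psi> e)"
| "sat A r (Exists i \<phi>) = (\<lambda>e. \<exists>a\<in>A. sat A r \<phi> (e(i := a)))"
| "sat A r (Forall i \<phi>) = (\<lambda>e. \<forall>a\<in>A. sat A r \<phi> (e(i := a)))"
| "sat A r (Disj X) = (\<lambda>e. \<exists>P\<in>rcset (cimage (sat A r) X). P e)"
| "sat A r (Conj X) = (\<lambda>e. \<forall>P\<in>rcset (cimage (sat A r) X). P e)"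

primrec fv :: "fm \<Rightarrow> nat set" where
  "fv Bot = {}"
| "fv (Leq i j) = {i, j}"
| "fv (Eql i j) = {i, j}"
| "fv (Neg \<phi>) = fv \<phi>"
| "fv (And \<phi> \<psi>) = fv \<phi> \<union> fv \<psi>"
| "fv (Or \<phi> \<psi>) = fv \<phi> \<union> fv \<psi>"
| "fv (Exists i \<phi>) = fv \<phi> - {i}"
| "fv (Forall i \<phi>) = fv \<phi> - {i}"
| "fv (Disj X) = \<Union> (rcset (cimage fv X))"
| "fv (Conj X) = \<Union> (rcset (cimage fv X))"

definition sentence :: "fm \<Rightarrow> bool" where
  "sentence \<phi> \<longleftrightarrow> fv \<phi> = {}"

text \<open>
  For a sentence the choice of the assignment is irrelevant (lemma \<open>sat_fv_cong\<close>); assignments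
  range over the whole type so that there is one even when \<open>A\<close> is empty.
\<close>

definition models :: "'a set \<Rightarrow> 'a rel \<Rightarrow> fm \<Rightarrow> bool" where
  "models A r \<phi> \<longleftrightarrow> (\<forall>e. sat A r \<phi> e)"

lemma sat_Disj [simp]: "sat A r (Disj X) e \<longleftrightarrow> (\<exists>\<phi>\<in>rcset X. sat A r \<phi> e)"
  by (auto simp: cimage.rep_eq)

lemma sat_Conj [simp]: "sat A r (Conj X) e \<longleftrightarrow> (\<forall>\<phi>\<in>rcset X. sat A r \<phi> e)"
  by (auto simp: cimage.rep_eq)

lemma fv_Disj [simp]: "fv (Disj X) = (\<Union>\<phi>\<in>rcset X. fv \<phi>)"
  by (auto simp: cimage.rep_eq)

lemma fv_Conj [simp]: "fv (Conj X) = (\<Union>\<phi>\<in>rcset X. fv \<phi>)"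
  by (auto simp: cimage.rep_eq)

declare sat.simps(9,10) [simp del] fv.simps(9,10) [simp del]

section \<open>The classes \<open>\<Sigma>\<^sub>n\<close>, \<open>\<Pi>\<^sub>n\<close> and d-\<open>\<Sigma>\<^sub>n\<close>\<close>

primrec quantifier_free :: "fm \<Rightarrow> bool" where
  "quantifier_free Bot = True"
| "quantifier_free (Leq i j) = True"
| "quantifier_free (Eql i j) = True"
| "quantifier_free (Neg \<phi>) = quantifier_free \<phi>"
| "quantifier_free (And \<phi> \<psi>) = (quantifier_free \<phi> \<and> quantifier_free \<psi>)"
| "quantifier_free (Or \<phi> \<psi>) = (quantifier_free \<phi> \<and> quantifier_free \<psi>)"
| "quantifier_free (Exists i \<phi>) = False"
| "quantifier_free (Forall i \<phi>) = False"
| "quantifier_free (Disj X) = False"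
| "quantifier_free (Conj X) = False"

definition Exs :: "nat list \<Rightarrow> fm \<Rightarrow> fm" where
  "Exs xs \<phi> = foldr Exists xs \<phi>"

definition Alls :: "nat list \<Rightarrow> fm \<Rightarrow> fm" where
  "Alls xs \<phi> = foldr Forall xs \<phi>"

text \<open>
  Only the finite levels of the hierarchy are defined; level \<open>n\<close> depends only on the levels
  below \<open>n\<close>, so these agree with the finite levels of the transfinite hierarchy.
\<close>

inductive is_Sigma :: "nat \<Rightarrow> fm \<Rightarrow> bool" and is_Pi :: "nat \<Rightarrow> fm \<Rightarrow> bool" where
  Sigma_0: "quantifier_free \<phi> \<Longrightarrow> is_Sigma 0 \<phi>"
| Pi_0: "quantifier_free \<phi> \<Longrightarrow> is_Pi 0 \<phi>"
| Sigma_pos: "n > 0 \<Longrightarrow> (\<forall>\<psi>\<in>rcset X. \<exists>xs \<phi> m. \<psi> = Exs xs \<phi> \<and> m < n \<and> is_Pi m \<phi>)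
    \<Longrightarrow> is_Sigma n (Disj X)"
| Pi_pos: "n > 0 \<Longrightarrow> (\<forall>\<psi>\<in>rcset X. \<exists>xs \<phi> m. \<psi> = Alls xs \<phi> \<and> m < n \<and> is_Sigma m \<phi>)
    \<Longrightarrow> is_Pi n (Conj X)"

definition is_d_Sigma :: "nat \<Rightarrow> fm \<Rightarrow> bool" where
  "is_d_Sigma n \<chi> \<longleftrightarrow> (\<exists>\<phi> \<psi>. \<chi> = And \<phi> \<psi> \<and> is_Sigma n \<phi> \<and> is_Pi n \<psi>)"

section \<open>Partial recursive functions and computably enumerable sets\<close>

datatype recf =
    Zero
  | Succ
  | Proj nat
  | Comp recf "recf list"
  | PrimRec recf recf
  | Mu recf

text \<open>
  \<open>evaluates p xs y\<close>: the program \<open>p\<close> converges on the arguments \<open>xs\<close> with value \<open>y\<close>. Arities are not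
  tracked: superfluous arguments are ignored, and there is no value if a needed argument is missing.
\<close>

inductive evaluates :: "recf \<Rightarrow> nat list \<Rightarrow> nat \<Rightarrow> bool" where
  evaluates_Zero: "evaluates Zero xs 0"
| evaluates_Succ: "evaluates Succ (x # xs) (Suc x)"
| evaluates_Proj: "i < length xs \<Longrightarrow> evaluates (Proj i) xs (xs ! i)"
| evaluates_Comp: "list_all2 (\<lambda>g y. evaluates g xs y) gs ys \<Longrightarrow> evaluates f ys z \<Longrightarrow> evaluates (Comp f gs) xs z"
| evaluates_PrimRec_0: "evaluates f xs y \<Longrightarrow> evaluates (PrimRec f g) (0 # xs) y"
| evaluates_PrimRec_Suc: "evaluates (PrimRec f g) (n # xs) y \<Longrightarrow> evaluates g (n # y # xs) z
    \<Longrightarrow> evaluates (PrimRec f g) (Suc n # xs) z"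
| evaluates_Mu: "evaluates f (n # xs) 0 \<Longrightarrow> (\<forall>m<n. \<exists>y>0. evaluates f (m # xs) y) \<Longrightarrow> evaluates (Mu f) xs n"

text \<open>The c.e. set enumerated by a program: the range of its unary partial function.\<close>

definition ce_set :: "recf \<Rightarrow> nat set" where
  "ce_set p = {y. \<exists>x. evaluates p [x] y}"

fun recf_code :: "recf \<Rightarrow> nat" where
  "recf_code Zero = prod_encode (0, 0)"
| "recf_code Succ = prod_encode (1, 0)"
| "recf_code (Proj i) = prod_encode (2, i)"
| "recf_code (Comp f gs) = prod_encode (3, prod_encode (recf_code f, list_encode (map recf_code gs)))"
| "recf_code (PrimRec f g) = prod_encode (4, prod_encode (recf_code f, recf_code g))"
| "recf_code (Mu f) = prod_encode (5, recf_code f)"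

section \<open>Computable infinitary formulas\<close>

text \<open>
  An infinitary formula is not a finite object, so a c.e. set of formulas is given by a c.e. set of
  codes. \<open>codes c \<phi>\<close> says that the number \<open>c\<close> is a code of \<open>\<phi>\<close>: a code of an infinitary
  disjunction or conjunction is an index of a c.e. set of codes of its members, hereditarily.
\<close>

inductive codes :: "nat \<Rightarrow> fm \<Rightarrow> bool" where
  codes_Bot: "codes (prod_encode (0, 0)) Bot"
| codes_Leq: "codes (prod_encode (1, prod_encode (i, j))) (Leq i j)"
| codes_Eql: "codes (prod_encode (2, prod_encode (i, j))) (Eql i j)"
| codes_Neg: "codes c \<phi> \<Longrightarrow> codes (prod_encode (3, c)) (Neg \<phi>)"
| codes_And: "codes c \<phi> \<Longrightarrow> codes d \<psi> \<Longrightarrow> codes (prod_encode (4, prod_encode (c, d))) (And \<phi> \<psi>)"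
| codes_Or: "codes c \<phi> \<Longrightarrow> codes d \<psi> \<Longrightarrow> codes (prod_encode (5, prod_encode (c, d))) (Or \<phi> \<psi>)"
| codes_Exists: "codes c \<phi> \<Longrightarrow> codes (prod_encode (6, prod_encode (i, c))) (Exists i \<phi>)"
| codes_Forall: "codes c \<phi> \<Longrightarrow> codes (prod_encode (7, prod_encode (i, c))) (Forall i \<phi>)"
| codes_Disj: "(\<forall>c\<in>ce_set p. codes c (F c))
    \<Longrightarrow> codes (prod_encode (8, recf_code p)) (Disj (acset (F ` ce_set p)))"
| codes_Conj: "(\<forall>c\<in>ce_set p. codes c (F c))
    \<Longrightarrow> codes (prod_encode (9, recf_code p)) (Conj (acset (F ` ce_set p)))"

definition computable_fm :: "fm \<Rightarrow> bool" where
  "computable_fm \<phi> \<longleftrightarrow> (\<exists>c. codes c \<phi>)"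

section \<open>Scott sentences\<close>

definition isomorphic :: "'a set \<Rightarrow> 'a rel \<Rightarrow> 'b set \<Rightarrow> 'b rel \<Rightarrow> bool" where
  "isomorphic A r B s \<longleftrightarrow>
    (\<exists>f. bij_betw f A B \<and> (\<forall>x\<in>A. \<forall>y\<in>A. (x, y) \<in> r \<longleftrightarrow> (f x, f y) \<in> s))"

text \<open>
  Every countable structure is isomorphic to one whose carrier is a set of natural numbers, so it
  suffices to test those; lemma \<open>scott_sentence_any_type\<close> extends this to arbitrary types.
\<close>

definition scott_sentence :: "'a set \<Rightarrow> 'a rel \<Rightarrow> fm \<Rightarrow> bool" where
  "scott_sentence A r \<phi> \<longleftrightarrow> sentence \<phi> \<and>
    (\<forall>(B :: nat set) s. s \<subseteq> B \<times> B \<longrightarrow> (models B s \<phi> \<longleftrightarrow> isomorphic A r B s))"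

section \<open>Hausdorff rank\<close>

text \<open>
  The linear order \<open>(A, r)\<close> is the sum over the index order \<open>I\<close> of its suborders
  \<open>(P i, Restr r (P i))\<close>. The pieces may be empty.
\<close>

definition is_ordered_sum :: "'i::linorder set \<Rightarrow> ('i \<Rightarrow> 'a set) \<Rightarrow> 'a set \<Rightarrow> 'a rel \<Rightarrow> bool" where
  "is_ordered_sum I P A r \<longleftrightarrow> linear_order_on A r \<and> A = (\<Union>i\<in>I. P i) \<and>
    (\<forall>i\<in>I. \<forall>j\<in>I. i < j \<longrightarrow> (\<forall>x\<in>P i. \<forall>y\<in>P j. (x, y) \<in> r \<and> x \<noteq> y))"

text \<open>As for formulas, only the finite ranks are defined. They do not depend on larger ranks.\<close>

inductive HR :: "nat \<Rightarrow> 'a set \<Rightarrow> 'a rel \<Rightarrow> bool" where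
  HR_0: "linear_order_on A r \<Longrightarrow> finite A \<Longrightarrow> HR 0 A r"
| HR_zeta_sum: "\<alpha> > 0 \<Longrightarrow> is_ordered_sum (UNIV :: int set) P A r
    \<Longrightarrow> (\<forall>i. \<exists>\<beta><\<alpha>. HR \<beta> (P i) (Restr r (P i))) \<Longrightarrow> HR \<alpha> A r"
| HR_finite_sum: "\<alpha> > 0 \<Longrightarrow> is_ordered_sum {..<k::nat} P A r
    \<Longrightarrow> (\<forall>i<k. HR \<alpha> (P i) (Restr r (P i))) \<Longrightarrow> HR \<alpha> A r"

text \<open>
  A relation rather than a function, since an order need not have a finite rank.
\<close>

definition has_hausdorff_rank :: "'a set \<Rightarrow> 'a rel \<Rightarrow> nat \<Rightarrow> bool" where
  "has_hausdorff_rank A r \<alpha> \<longleftrightarrow> HR \<alpha> A r \<and> (\<forall>\<beta><\<alpha>. \<not> HR \<beta> A r)"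

section \<open>Basic facts about the definitions\<close>

lemma sat_fv_cong: "\<forall>i\<in>fv \<phi>. e i = e' i \<Longrightarrow> sat A r \<phi> e \<longleftrightarrow> sat A r \<phi> e'"
proof (induction \<phi> arbitrary: e e')
  case (Exists i \<phi>)
  have "sat A r \<phi> (e(i := a)) \<longleftrightarrow> sat A r \<phi> (e'(i := a))" for a
    using Exists.prems by (intro Exists.IH) simp
  then show ?case by simp
next
  case (Forall i \<phi>)
  have "sat A r \<phi> (e(i := a)) \<longleftrightarrow> sat A r \<phi> (e'(i := a))" for a
    using Forall.prems by (intro Forall.IH) simp
  then show ?case by simp
next
  case (Neg \<phi>)
  then show ?case by (metis fv.simps(4) sat.simps(4))
next
  case (And \<phi> \<psi>)
  then show ?case by (metis Un_iff fv.simps(5) sat.simps(5))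
next
  case (Or \<phi> \<psi>)
  then show ?case by (metis Un_iff fv.simps(6) sat.simps(6))
next
  case (Disj X)
  have "sat A r \<phi> e \<longleftrightarrow> sat A r \<phi> e'" if "\<phi> \<in> rcset X" for \<phi>
    using Disj.prems that by (intro Disj.IH) simp_all
  then show ?case by simp
next
  case (Conj X)
  have "sat A r \<phi> e \<longleftrightarrow> sat A r \<phi> e'" if "\<phi> \<in> rcset X" for \<phi>
    using Conj.prems that by (intro Conj.IH) simp_all
  then show ?case by simp
qed simp_all

lemma sat_iso:
  assumes f: "bij_betw f A B" and rs: "\<forall>x\<in>A. \<forall>y\<in>A. (x, y) \<in> r \<longleftrightarrow> (f x, f y) \<in> s"
  shows "\<forall>i\<in>fv \<phi>. e i \<in> A \<Longrightarrow> sat A r \<phi> e \<longleftrightarrow> sat B s \<phi> (f \<circ> e)"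
proof (induction \<phi> arbitrary: e)
  case (Leq i j)
  then show ?case using rs by simp
next
  case (Eql i j)
  then show ?case using bij_betw_imp_inj_on[OF f] by (simp add: inj_on_eq_iff)
next
  case (Exists i \<phi>)
  have "sat A r \<phi> (e(i := a)) \<longleftrightarrow> sat B s \<phi> ((f \<circ> e)(i := f a))" if "a \<in> A" for a
    unfolding fun_upd_comp[symmetric] using Exists.prems that by (intro Exists.IH) simp
  then have "(\<exists>a\<in>A. sat A r \<phi> (e(i := a))) \<longleftrightarrow> (\<exists>b\<in>f ` A. sat B s \<phi> ((f \<circ> e)(i := b)))"
    by blast
  then show ?case by (simp only: sat.simps bij_betw_imp_surj_on[OF f])
next
  case (Forall i \<phi>)
  have "sat A r \<phi> (e(i := a)) \<longleftrightarrow> sat B s \<phi> ((f \<circ> e)(i := f a))" if "a \<in> A" for a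
    unfolding fun_upd_comp[symmetric] using Forall.prems that by (intro Forall.IH) simp
  then have "(\<forall>a\<in>A. sat A r \<phi> (e(i := a))) \<longleftrightarrow> (\<forall>b\<in>f ` A. sat B s \<phi> ((f \<circ> e)(i := b)))"
    by blast
  then show ?case by (simp only: sat.simps bij_betw_imp_surj_on[OF f])
next
  case (Neg \<phi>)
  then show ?case by (metis fv.simps(4) sat.simps(4))
next
  case (And \<phi> \<psi>)
  then show ?case by (metis Un_iff fv.simps(5) sat.simps(5))
next
  case (Or \<phi> \<psi>)
  then show ?case by (metis Un_iff fv.simps(6) sat.simps(6))
next
  case (Disj X)
  have "sat A r \<phi> e \<longleftrightarrow> sat B s \<phi> (f \<circ> e)" if "\<phi> \<in> rcset X" for \<phi>
    using Disj.prems that by (intro Disj.IH) simp_all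
  then show ?case unfolding sat_Disj by blast
next
  case (Conj X)
  have "sat A r \<phi> e \<longleftrightarrow> sat B s \<phi> (f \<circ> e)" if "\<phi> \<in> rcset X" for \<phi>
    using Conj.prems that by (intro Conj.IH) simp_all
  then show ?case unfolding sat_Conj by blast
qed simp_all

lemma models_iso:
  assumes "sentence \<phi>" "isomorphic A r B s"
  shows "models A r \<phi> \<longleftrightarrow> models B s \<phi>"
proof -
  obtain f where f: "bij_betw f A B" "\<forall>x\<in>A. \<forall>y\<in>A. (x, y) \<in> r \<longleftrightarrow> (f x, f y) \<in> s"
    using assms(2) by (auto simp: isomorphic_def)
  have "sat A r \<phi> e = sat B s \<phi> (f \<circ> e)" for e
    using sat_iso[OF f] assms(1) by (simp add: sentence_def)
  moreover have "sat B s \<phi> e = sat B s \<phi> e'" for e e'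
    using sat_fv_cong[of \<phi> e e'] assms(1) by (simp add: sentence_def)
  ultimately show ?thesis unfolding models_def by metis
qed

lemma isomorphic_sym: "isomorphic A r B s \<Longrightarrow> isomorphic B s A r"
proof -
  assume "isomorphic A r B s"
  then obtain f where f: "bij_betw f A B" "\<forall>x\<in>A. \<forall>y\<in>A. (x, y) \<in> r \<longleftrightarrow> (f x, f y) \<in> s"
    by (auto simp: isomorphic_def)
  let ?g = "inv_into A f"
  have "?g x \<in> A" "f (?g x) = x" if "x \<in> B" for x
    using that f(1) by (auto simp: bij_betw_def inv_into_into f_inv_into_f)
  then show ?thesis
    unfolding isomorphic_def using bij_betw_inv_into[OF f(1)] f(2) by metis
qed

lemma isomorphic_trans: "isomorphic A r B s \<Longrightarrow> isomorphic B s C t \<Longrightarrow> isomorphic A r C t"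
proof -
  assume "isomorphic A r B s" "isomorphic B s C t"
  then obtain f g where f: "bij_betw f A B" "\<forall>x\<in>A. \<forall>y\<in>A. (x, y) \<in> r \<longleftrightarrow> (f x, f y) \<in> s"
    and g: "bij_betw g B C" "\<forall>x\<in>B. \<forall>y\<in>B. (x, y) \<in> s \<longleftrightarrow> (g x, g y) \<in> t"
    unfolding isomorphic_def by blast
  have "f x \<in> B" if "x \<in> A" for x using that f(1) by (auto simp: bij_betw_def)
  then have "bij_betw (g \<circ> f) A C \<and>
      (\<forall>x\<in>A. \<forall>y\<in>A. (x, y) \<in> r \<longleftrightarrow> ((g \<circ> f) x, (g \<circ> f) y) \<in> t)"
    using bij_betw_trans[OF f(1) g(1)] f(2) g(2) by simp
  then show ?thesis unfolding isomorphic_def by blast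
qed

lemma scott_sentence_any_type:
  fixes B :: "'b set"
  assumes "scott_sentence A r \<phi>" "countable B" "s \<subseteq> B \<times> B"
  shows "models B s \<phi> \<longleftrightarrow> isomorphic A r B s"
proof -
  obtain h :: "'b \<Rightarrow> nat" where h: "inj_on h B"
    using assms(2) by (auto simp: countable_def)
  define B' s' where "B' = h ` B" and "s' = map_prod h h ` s"
  have iso: "isomorphic B s B' s'"
    unfolding isomorphic_def
  proof (intro exI conjI ballI)
    show "bij_betw h B B'" using h by (simp add: B'_def bij_betw_def)
    fix x y assume "x \<in> B" "y \<in> B"
    moreover have "x = x' \<and> y = y'" if "h x = h x'" "h y = h y'" "(x', y') \<in> s" for x' y'
      using that inj_onD[OF h] assms(3) \<open>x \<in> B\<close> \<open>y \<in> B\<close> by blast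
    ultimately show "(x, y) \<in> s \<longleftrightarrow> (h x, h y) \<in> s'"
      unfolding s'_def by force
  qed
  have "s' \<subseteq> B' \<times> B'" using assms(3) by (auto simp: s'_def B'_def)
  then have "models B' s' \<phi> \<longleftrightarrow> isomorphic A r B' s'"
    using assms(1) by (simp add: scott_sentence_def)
  moreover have "models B s \<phi> \<longleftrightarrow> models B' s' \<phi>"
    using models_iso[OF _ iso] assms(1) by (simp add: scott_sentence_def)
  ultimately show ?thesis using iso isomorphic_trans isomorphic_sym by metis
qed

lemma recf_code_inj: "recf_code p = recf_code q \<Longrightarrow> p = q"
proof (induction p arbitrary: q)
  case (Comp f gs)
  obtain f' gs' where q: "q = Comp f' gs'"
    using Comp.prems by (cases q) simp_all
  then have "recf_code f = recf_code f'" and gs: "map recf_code gs = map recf_code gs'"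
    using Comp.prems by (simp_all add: list_encode_eq)
  have "gs = gs'"
    using gs by (rule list.inj_map_strong[rotated]) (rule Comp.IH(2))
  then show ?case using q Comp.IH(1) \<open>recf_code f = recf_code f'\<close> by blast
next
  case (PrimRec f g)
  obtain f' g' where q: "q = PrimRec f' g'"
    using PrimRec.prems by (cases q) simp_all
  then have "recf_code f = recf_code f'" "recf_code g = recf_code g'"
    using PrimRec.prems by simp_all
  then show ?case using q PrimRec.IH by blast
next
  case (Mu f)
  obtain f' where q: "q = Mu f'"
    using Mu.prems by (cases q) simp_all
  then have "recf_code f = recf_code f'"
    using Mu.prems by simp
  then show ?case using q Mu.IH by blast
next
  case Zero
  then show ?case by (cases q) simp_all
next
  case Succ
  then show ?case by (cases q) simp_all
next
  case (Proj i)
  then show ?case by (cases q) simp_all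
qed

inductive_cases evaluates_elims:
  "evaluates Zero xs z" "evaluates Succ xs z" "evaluates (Proj i) xs z" "evaluates (Comp f gs) xs z"
  "evaluates (PrimRec f g) (0 # xs) z" "evaluates (PrimRec f g) (Suc n # xs) z" "evaluates (Mu f) xs z"

lemma evaluates_det: "evaluates p xs y \<Longrightarrow> evaluates p xs z \<Longrightarrow> y = z"
proof (induction arbitrary: z rule: evaluates.induct)
  case (evaluates_Comp xs gs ys f w)
  from evaluates_Comp.prems obtain ys' where ys': "list_all2 (\<lambda>g y. evaluates g xs y) gs ys'" "evaluates f ys' z"
    by (rule evaluates_elims(4))
  have "ys = ys'"
    using evaluates_Comp.IH(1) ys'(1) unfolding list_all2_conv_all_nth by (metis nth_equalityI)
  then show ?case using evaluates_Comp.IH(2) ys'(2) by blast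
next
  case (evaluates_Mu f n xs)
  from evaluates_Mu.prems have z: "evaluates f (z # xs) 0" "\<forall>m<z. \<exists>y>0. evaluates f (m # xs) y"
    by (blast elim: evaluates_elims(7))+
  show ?case using evaluates_Mu.IH z by (metis less_irrefl linorder_neqE_nat)
next
  case (evaluates_PrimRec_Suc f g n xs y w)
  from evaluates_PrimRec_Suc.prems obtain y' where "evaluates (PrimRec f g) (n # xs) y'" "evaluates g (n # y' # xs) z"
    by (rule evaluates_elims(6))
  then show ?case using evaluates_PrimRec_Suc.IH by blast
qed (blast elim: evaluates_elims(1-3,5))+

inductive_cases codes_elims:
  "codes (prod_encode (0, 0)) \<psi>"
  "codes (prod_encode (1, n)) \<psi>"
  "codes (prod_encode (2, n)) \<psi>"
  "codes (prod_encode (3, n)) \<psi>"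
  "codes (prod_encode (4, n)) \<psi>"
  "codes (prod_encode (5, n)) \<psi>"
  "codes (prod_encode (6, n)) \<psi>"
  "codes (prod_encode (7, n)) \<psi>"
  "codes (prod_encode (8, n)) \<psi>"
  "codes (prod_encode (9, n)) \<psi>"

lemma codes_unique: "codes c \<phi> \<Longrightarrow> codes c \<psi> \<Longrightarrow> \<phi> = \<psi>"
proof (induction arbitrary: \<psi> rule: codes.induct)
  case (codes_Disj p F)
  obtain q G where "recf_code p = recf_code q" and \<psi>: "\<psi> = Disj (acset (G ` ce_set q))"
      "\<forall>c\<in>ce_set q. codes c (G c)"
    using codes_Disj(2) by (rule codes_elims(9))
  then have "q = p" using recf_code_inj by metis
  then have "F ` ce_set p = G ` ce_set q" using codes_Disj(1) \<psi>(2) by (intro image_cong) blast+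
  then show ?case using \<psi>(1) by simp
next
  case (codes_Conj p F)
  obtain q G where "recf_code p = recf_code q" and \<psi>: "\<psi> = Conj (acset (G ` ce_set q))"
      "\<forall>c\<in>ce_set q. codes c (G c)"
    using codes_Conj(2) by (rule codes_elims(10))
  then have "q = p" using recf_code_inj by metis
  then have "F ` ce_set p = G ` ce_set q" using codes_Conj(1) \<psi>(2) by (intro image_cong) blast+
  then show ?case using \<psi>(1) by simp
qed (erule codes_elims; simp; blast)+

end

theory Submission
  imports Defs
begin

text \<open>
  Call two elements near if only finitely many elements lie between them. An order of Hausdorff rank 1
  has finitely many nearness classes (blocks), each finite or of type \<open>\<omega>\<close>, \<open>\<omega>*\<close> or \<open>\<zeta>\<close>, so up to
  isomorphism it is given by the sequence of the blocks, recording for each whether it has a least and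
  a greatest element and, if both, how many elements there are. "Infinitely many elements between" is a
  countable conjunction of \<open>\<Sigma>\<^sub>1\<close> formulas, so it is \<open>\<Pi>\<^sub>2\<close> that elements lie in different blocks, or
  that an element is the first or the last one of its block. Hence a \<open>\<Sigma>\<^sub>3\<close> sentence states that there
  are at least the required blocks and block ends, in the right order, and a \<open>\<Pi>\<^sub>3\<close> sentence states
  that there are no further blocks and no further block ends.
\<close>

section \<open>Computable families of formulas\<close>

text \<open>The obstacle is that the Pi_3 half must not refer to the witnesses of the Sigma_3 half:
  "every element is near one of the witnesses" is Pi_3 in the witnesses, and quantifying them
  existentially would lead to Sigma_4. The Pi_3 half therefore only counts. Among any
  \<open>k + 1\<close> elements two are near; any \<open>m + 1\<close> elements contain a repetition
  or one that is not first in its block; likewise for last elements. Each is a universal statement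
  with a Sigma_2 matrix and without parameters. As the witnesses already attain the bounds, no block
  and no block end can be left over.

  Two orders satisfying both halves are not compared directly: each is mapped onto the same suborder
  of the lexicographic product of \<open>nat\<close> and \<open>int\<close>, an element going to the
  index of its block and its signed distance from the witness there.

  Computability asks for codes of the members of each conjunction that are found uniformly. To keep
  this manageable, all conditions are brought into a single form of clause, whose negation serves in
  the Pi_3 half.\<close>

definition recursive :: "nat \<Rightarrow> (nat list \<Rightarrow> nat) \<Rightarrow> bool" where
  "recursive k f \<longleftrightarrow> (\<exists>p. \<forall>xs. length xs = k \<longrightarrow> evaluates p xs (f xs))"

primrec const_recf :: "nat \<Rightarrow> recf" where
  "const_recf 0 = Zero"
| "const_recf (Suc c) = Comp Succ [const_recf c]"

lemma evaluates_const_recf: "evaluates (const_recf c) xs c"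
  by (induction c) (auto intro: evaluates.intros)

lemma recursive_const: "recursive k (\<lambda>xs. c)"
  unfolding recursive_def using evaluates_const_recf by blast

lemma recursive_nth: "i < k \<Longrightarrow> recursive k (\<lambda>xs. xs ! i)"
  unfolding recursive_def by (auto intro: evaluates_Proj)

lemma recursive_comp:
  assumes "recursive (length gs) f" "\<forall>g\<in>set gs. recursive k g"
  shows "recursive k (\<lambda>xs. f (map (\<lambda>g. g xs) gs))"
proof -
  obtain p where p: "\<And>xs. length xs = length gs \<Longrightarrow> evaluates p xs (f xs)"
    using assms(1) by (auto simp: recursive_def)
  obtain q where q: "\<And>g xs. g \<in> set gs \<Longrightarrow> length xs = k \<Longrightarrow> evaluates (q g) xs (g xs)"
    using assms(2) unfolding recursive_def by metis
  have "evaluates (Comp p (map q gs)) xs (f (map (\<lambda>g. g xs) gs))" if "length xs = k" for xs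
    by (rule evaluates_Comp[where ys = "map (\<lambda>g. g xs) gs"])
      (simp_all add: p q that list_all2_conv_all_nth)
  then show ?thesis unfolding recursive_def by blast
qed

text \<open>This form of composition is for arguments that arise by reshaping the list, as in
  \<open>h xs # xs\<close> or \<open>drop 2 xs\<close>, where no explicit list of component
  functions is given.\<close>

lemma recursive_comp_list:
  assumes "recursive m f" "\<forall>i<m. recursive k (\<lambda>xs. h xs ! i)" "\<forall>xs. length xs = k \<longrightarrow> length (h xs) = m"
  shows "recursive k (\<lambda>xs. f (h xs))"
proof -
  let ?gs = "map (\<lambda>i xs. h xs ! i) [0..<m]"
  have "map (\<lambda>g. g xs) ?gs = h xs" if "length xs = k" for xs
    using assms(3) that by (intro nth_equalityI) simp_all
  moreover have "recursive k (\<lambda>xs. f (map (\<lambda>g. g xs) ?gs))"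
    using assms by (intro recursive_comp) auto
  ultimately show ?thesis by (simp add: recursive_def)
qed

lemma recursive_Suc: "recursive k f \<Longrightarrow> recursive k (\<lambda>xs. Suc (f xs))"
proof -
  have "recursive 1 (\<lambda>xs. Suc (hd xs))"
    unfolding recursive_def by (rule exI[of _ Succ]) (auto simp: length_Suc_conv intro: evaluates_Succ)
  then show "recursive k f \<Longrightarrow> recursive k (\<lambda>xs. Suc (f xs))"
    using recursive_comp[of "[f]" "\<lambda>xs. Suc (hd xs)" k] by simp
qed

lemma recursive_rec_nat:
  assumes "recursive k b" "recursive (k + 2) (\<lambda>xs. G (xs ! 0) (xs ! 1) (drop 2 xs))" "recursive k h"
  shows "recursive k (\<lambda>xs. rec_nat (b xs) (\<lambda>n y. G n y xs) (h xs))"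
proof -
  obtain p q where p: "\<And>xs. length xs = k \<Longrightarrow> evaluates p xs (b xs)"
    and q: "\<And>xs. length xs = k + 2 \<Longrightarrow> evaluates q xs (G (xs ! 0) (xs ! 1) (drop 2 xs))"
    using assms by (auto simp: recursive_def)
  have *: "evaluates (PrimRec p q) (n # xs) (rec_nat (b xs) (\<lambda>n y. G n y xs) n)"
    if "length xs = k" for n xs
  proof (induction n)
    case 0
    then show ?case using p[OF that] by (simp add: evaluates_PrimRec_0)
  next
    case (Suc n)
    then show ?case using q[of "n # _ # xs"] that
      by (auto intro!: evaluates_PrimRec_Suc)
  qed
  \<comment> \<open>\<open>PrimRec\<close> recurses on its first argument, so the counter enters as
    a new argument in front, which is then replaced by \<open>h xs\<close>.\<close>
  define f where "f = (\<lambda>xs. rec_nat (b (tl xs)) (\<lambda>n y. G n y (tl xs)) (hd xs))"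
  have "recursive (Suc k) f"
    unfolding recursive_def f_def
    by (rule exI[of _ "PrimRec p q"]) (auto simp: length_Suc_conv *)
  then have "recursive k (\<lambda>xs. f (h xs # xs))"
    by (rule recursive_comp_list) (simp_all add: All_less_Suc2 assms(3) recursive_nth)
  then show ?thesis by (simp add: f_def)
qed

lemma recursive_iter:
  assumes "recursive (k + 2) (\<lambda>xs. G (xs ! 0) (xs ! 1))" "recursive k b" "recursive k h"
  shows "recursive k (\<lambda>xs. rec_nat (b xs) G (h xs))"
  using recursive_rec_nat[of k b "\<lambda>n y xs. G n y" h] assms by simp

text \<open>A primitive recursion whose step ignores both the counter and the previous value yields
  \<open>f\<close> at 0 and \<open>g\<close> everywhere else.\<close>

lemma recursive_if:
  assumes "recursive k h" "recursive k f" "recursive k g"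
  shows "recursive k (\<lambda>xs. if h xs = 0 then f xs else g xs)"
proof -
  have "recursive (k + 2) (\<lambda>xs. g (drop 2 xs))"
  proof (rule recursive_comp_list[OF assms(3)])
    show "\<forall>i<k. recursive (k + 2) (\<lambda>xs. drop 2 xs ! i)"
    proof (intro allI impI)
      fix i assume "i < k"
      then have "recursive (k + 2) (\<lambda>xs. xs ! (2 + i))" by (intro recursive_nth) simp
      moreover have "drop 2 xs ! i = xs ! (2 + i)" if "length xs = k + 2" for xs :: "nat list"
        using that by simp
      ultimately show "recursive (k + 2) (\<lambda>xs. drop 2 xs ! i)"
        by (simp add: recursive_def)
    qed
  qed simp
  then have "recursive k (\<lambda>xs. rec_nat (f xs) (\<lambda>n y. g xs) (h xs))"
    using recursive_rec_nat[of k f "\<lambda>n y xs. g xs" h] assms by simp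
  moreover have "rec_nat a (\<lambda>n y. b) m = (if m = 0 then a else b)" for a b :: nat and m
    by (cases m) simp_all
  ultimately show ?thesis by simp
qed

lemma recursive_add: "recursive k f \<Longrightarrow> recursive k g \<Longrightarrow> recursive k (\<lambda>xs. f xs + g xs)"
proof -
  assume fg: "recursive k f" "recursive k g"
  have "recursive k (\<lambda>xs. rec_nat (f xs) (\<lambda>n y. Suc y) (g xs))"
    by (intro recursive_iter recursive_Suc recursive_nth fg) simp
  moreover have "rec_nat a (\<lambda>n y. Suc y) m = a + m" for a m
    by (induction m) simp_all
  ultimately show ?thesis by simp
qed

lemma recursive_triangle: "recursive k f \<Longrightarrow> recursive k (\<lambda>xs. triangle (f xs))"
proof -
  assume f: "recursive k f"
  have "recursive k (\<lambda>xs. rec_nat 0 (\<lambda>n y. y + Suc n) (f xs))"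
    by (intro recursive_iter recursive_const recursive_add recursive_Suc recursive_nth f) simp_all
  moreover have "rec_nat 0 (\<lambda>n y. y + Suc n) m = triangle m" for m
    by (induction m) simp_all
  ultimately show ?thesis by simp
qed

lemma recursive_prod_encode:
  "recursive k f \<Longrightarrow> recursive k g \<Longrightarrow> recursive k (\<lambda>xs. prod_encode (f xs, g xs))"
  unfolding prod_encode_def by (auto intro!: recursive_add recursive_triangle)

text \<open>Parity and halving serve to merge two sequences of formulas into one.\<close>

lemma recursive_mod2: "recursive k f \<Longrightarrow> recursive k (\<lambda>xs. f xs mod 2)"
proof -
  assume f: "recursive k f"
  have "recursive k (\<lambda>xs. rec_nat 0 (\<lambda>n y. if y = 0 then 1 else 0) (f xs))"
    by (intro recursive_iter recursive_const recursive_if recursive_nth f) simp_all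
  moreover have "rec_nat 0 (\<lambda>n y. if y = 0 then 1 else 0) m = m mod 2" for m :: nat
    by (induction m) (simp_all, presburger)
  ultimately show ?thesis by simp
qed

lemma recursive_div2: "recursive k f \<Longrightarrow> recursive k (\<lambda>xs. f xs div 2)"
proof -
  assume f: "recursive k f"
  have "recursive k (\<lambda>xs. rec_nat 0 (\<lambda>n y. y + n mod 2) (f xs))"
    by (intro recursive_iter recursive_const recursive_add recursive_mod2 recursive_nth f) simp_all
  moreover have "rec_nat 0 (\<lambda>n y. y + n mod 2) m = m div 2" for m :: nat
    by (induction m) (simp_all, presburger)
  ultimately show ?thesis by simp
qed

text \<open>
  The code of a disjunction or conjunction with a single member contains the code of a program that
  enumerates the code of the member, and this program has to be found uniformly.
\<close>

lemma recursive_const_recf_code: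
  "recursive k f \<Longrightarrow> recursive k (\<lambda>xs. recf_code (const_recf (f xs)))"
proof -
  assume f: "recursive k f"
  \<comment> \<open>\<open>?G\<close> turns the code of a program \<open>p\<close> into that of
    \<open>Comp Succ [p]\<close>; here \<open>Suc (prod_encode (y, 0))\<close> is the code of a
    one-element list.\<close>
  let ?G = "\<lambda>(n::nat) y. prod_encode (3, prod_encode (prod_encode (1, 0), Suc (prod_encode (y, 0))))"
  have "recursive k (\<lambda>xs. rec_nat (prod_encode (0, 0)) ?G (f xs))"
    by (intro recursive_iter recursive_const recursive_prod_encode recursive_Suc recursive_nth f) simp
  moreover have "rec_nat (prod_encode (0, 0)) ?G c = recf_code (const_recf c)" for c
    by (induction c) simp_all
  ultimately show ?thesis by simp
qed

section \<open>Sequences of formulas with computable codes\<close>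

lemma ce_set_total: "(\<And>x. evaluates p [x] (f x)) \<Longrightarrow> ce_set p = range f"
  unfolding ce_set_def using evaluates_det by blast

text \<open>Computability of every single \<open>H n\<close> would not be enough: for the members to
  form a c.e. set, one recursive function has to find a code of \<open>H n\<close> from
  \<open>n\<close>.\<close>

definition uniform :: "(nat \<Rightarrow> fm) \<Rightarrow> bool" where
  "uniform H \<longleftrightarrow> (\<exists>g. recursive 1 (\<lambda>xs. g (xs ! 0)) \<and> (\<forall>n. codes (g n) (H n)))"

lemma uniformI: "recursive 1 (\<lambda>xs. g (xs ! 0)) \<Longrightarrow> (\<And>n. codes (g n) (H n)) \<Longrightarrow> uniform H"
  unfolding uniform_def by blast

lemma uniform_const: "computable_fm \<phi> \<Longrightarrow> uniform (\<lambda>n. \<phi>)"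
  unfolding computable_fm_def using uniformI[OF recursive_const, of _ "\<lambda>n. \<phi>"] by auto

text \<open>The map \<open>G\<close> on codes mirrors the operation \<open>T\<close> on formulas. It
  suffices that composing with \<open>G\<close> preserves recursiveness, which the closure rules for
  \<open>recursive\<close> settle for each connective.\<close>

lemma uniform_map:
  assumes "uniform H" "\<And>k f. recursive k f \<Longrightarrow> recursive k (\<lambda>xs. G (f xs))"
    "\<And>c \<phi>. codes c \<phi> \<Longrightarrow> codes (G c) (T \<phi>)"
  shows "uniform (\<lambda>n. T (H n))"
proof -
  obtain g where g: "recursive 1 (\<lambda>xs. g (xs ! 0))" "\<And>n. codes (g n) (H n)"
    using assms(1) by (auto simp: uniform_def)
  show ?thesis
    by (rule uniformI[where g = "\<lambda>n. G (g n)"]) (intro assms(2,3) g)+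
qed

lemma uniform_map2:
  assumes "uniform H" "uniform J"
    "\<And>k f g. recursive k f \<Longrightarrow> recursive k g \<Longrightarrow> recursive k (\<lambda>xs. G (f xs) (g xs))"
    "\<And>c d \<phi> \<psi>. codes c \<phi> \<Longrightarrow> codes d \<psi> \<Longrightarrow> codes (G c d) (T \<phi> \<psi>)"
  shows "uniform (\<lambda>n. T (H n) (J n))"
proof -
  obtain g h where g: "recursive 1 (\<lambda>xs. g (xs ! 0))" "\<And>n. codes (g n) (H n)"
    and h: "recursive 1 (\<lambda>xs. h (xs ! 0))" "\<And>n. codes (h n) (J n)"
    using assms(1,2) by (auto simp: uniform_def)
  show ?thesis
    by (rule uniformI[where g = "\<lambda>n. G (g n) (h n)"]) (intro assms(3,4) g h)+
qed

lemma uniform_Leq: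
  "recursive 1 (\<lambda>xs. f (xs ! 0)) \<Longrightarrow> recursive 1 (\<lambda>xs. g (xs ! 0)) \<Longrightarrow> uniform (\<lambda>n. Leq (f n) (g n))"
  by (rule uniformI[where g = "\<lambda>n. prod_encode (1, prod_encode (f n, g n))"])
    (intro recursive_prod_encode recursive_const codes.intros | assumption)+

lemma uniform_Eql:
  "recursive 1 (\<lambda>xs. f (xs ! 0)) \<Longrightarrow> recursive 1 (\<lambda>xs. g (xs ! 0)) \<Longrightarrow> uniform (\<lambda>n. Eql (f n) (g n))"
  by (rule uniformI[where g = "\<lambda>n. prod_encode (2, prod_encode (f n, g n))"])
    (intro recursive_prod_encode recursive_const codes.intros | assumption)+

lemma uniform_Neg: "uniform H \<Longrightarrow> uniform (\<lambda>n. Neg (H n))"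
  by (rule uniform_map[OF _ _ codes_Neg]) (intro recursive_prod_encode recursive_const | assumption)+

lemma uniform_And: "uniform H \<Longrightarrow> uniform J \<Longrightarrow> uniform (\<lambda>n. And (H n) (J n))"
  by (rule uniform_map2[OF _ _ _ codes_And]) (intro recursive_prod_encode recursive_const | assumption)+

lemma uniform_Or: "uniform H \<Longrightarrow> uniform J \<Longrightarrow> uniform (\<lambda>n. Or (H n) (J n))"
  by (rule uniform_map2[OF _ _ _ codes_Or]) (intro recursive_prod_encode recursive_const | assumption)+

lemma uniform_Exists: "uniform H \<Longrightarrow> uniform (\<lambda>n. Exists i (H n))"
  by (rule uniform_map[OF _ _ codes_Exists]) (intro recursive_prod_encode recursive_const | assumption)+

lemma uniform_Forall: "uniform H \<Longrightarrow> uniform (\<lambda>n. Forall i (H n))"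
  by (rule uniform_map[OF _ _ codes_Forall]) (intro recursive_prod_encode recursive_const | assumption)+

lemma codes_singleton:
  assumes "codes c \<phi>"
  shows "codes (prod_encode (8, recf_code (const_recf c))) (Disj (acset {\<phi>}))"
    "codes (prod_encode (9, recf_code (const_recf c))) (Conj (acset {\<phi>}))"
proof -
  have "ce_set (const_recf c) = {c}"
    using ce_set_total[OF evaluates_const_recf] by simp
  then show "codes (prod_encode (8, recf_code (const_recf c))) (Disj (acset {\<phi>}))"
    "codes (prod_encode (9, recf_code (const_recf c))) (Conj (acset {\<phi>}))"
    using codes_Disj[of "const_recf c" "\<lambda>_. \<phi>"] codes_Conj[of "const_recf c" "\<lambda>_. \<phi>"] assms
    by simp_all
qed

lemma uniform_Disj_singleton: "uniform H \<Longrightarrow> uniform (\<lambda>n. Disj (acset {H n}))"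
  by (rule uniform_map[OF _ _ codes_singleton(1)])
    (intro recursive_prod_encode recursive_const recursive_const_recf_code | assumption)+

lemma uniform_Conj_singleton: "uniform H \<Longrightarrow> uniform (\<lambda>n. Conj (acset {H n}))"
  by (rule uniform_map[OF _ _ codes_singleton(2)])
    (intro recursive_prod_encode recursive_const recursive_const_recf_code | assumption)+

text \<open>The formula grows with \<open>n\<close>, so its code is computed by a primitive
  recursion that runs parallel to the one building the formula.\<close>

lemma uniform_rec_And:
  assumes "computable_fm \<phi>" "uniform J"
  shows "uniform (rec_nat \<phi> (\<lambda>n \<psi>. And \<psi> (J n)))"
proof -
  obtain c g where c: "codes c \<phi>" and g: "recursive 1 (\<lambda>xs. g (xs ! 0))" "\<And>n. codes (g n) (J n)"
    using assms by (auto simp: computable_fm_def uniform_def)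
  let ?G = "\<lambda>n y. prod_encode (4, prod_encode (y, g n))"
  have "recursive (1 + 2) (\<lambda>xs. g (xs ! 0))"
    using recursive_comp[of "[\<lambda>xs. xs ! 0]" "\<lambda>xs. g (xs ! 0)" "1 + 2"] g(1)
    by (simp add: recursive_nth)
  then have "recursive 1 (\<lambda>xs. rec_nat c ?G (xs ! 0))"
    by (intro recursive_iter recursive_const recursive_prod_encode recursive_nth) simp_all
  moreover have "codes (rec_nat c ?G n) (rec_nat \<phi> (\<lambda>n \<psi>. And \<psi> (J n)) n)" for n
    by (induction n) (simp_all add: c g(2) codes_And)
  ultimately show ?thesis by (rule uniformI)
qed

text \<open>Listed downwards so that one more variable means one more outermost quantifier, which a
  primitive recursion on codes can add.\<close>

primrec vars :: "nat \<Rightarrow> nat \<Rightarrow> nat list" where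
  "vars K 0 = []"
| "vars K (Suc n) = (K + n) # vars K n"

lemma set_vars: "set (vars K n) = {K..<K + n}"
  by (induction n) auto

lemma uniform_Exs_vars:
  assumes "uniform H"
  shows "uniform (\<lambda>n. Exs (vars K (Suc n)) (H n))"
proof -
  obtain g where g: "recursive 1 (\<lambda>xs. g (xs ! 0))" "\<And>n. codes (g n) (H n)"
    using assms by (auto simp: uniform_def)
  let ?G = "\<lambda>n y. prod_encode (6, prod_encode (K + n, y))"
  have "recursive 1 (\<lambda>xs. rec_nat (g (xs ! 0)) ?G (Suc (xs ! 0)))"
    by (intro recursive_iter recursive_const recursive_prod_encode recursive_nth recursive_add
        recursive_Suc g) simp_all
  moreover have "codes c \<phi> \<Longrightarrow> codes (rec_nat c ?G n) (Exs (vars K n) \<phi>)" for n c \<phi>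
    by (induction n) (simp_all add: Exs_def codes_Exists)
  ultimately show ?thesis by (intro uniformI[where g = "\<lambda>x. rec_nat (g x) ?G (Suc x)"]) (simp_all only: g)
qed

lemma uniform_Alls_vars:
  assumes "uniform H"
  shows "uniform (\<lambda>n. Alls (vars K (Suc n)) (H n))"
proof -
  obtain g where g: "recursive 1 (\<lambda>xs. g (xs ! 0))" "\<And>n. codes (g n) (H n)"
    using assms by (auto simp: uniform_def)
  let ?G = "\<lambda>n y. prod_encode (7, prod_encode (K + n, y))"
  have "recursive 1 (\<lambda>xs. rec_nat (g (xs ! 0)) ?G (Suc (xs ! 0)))"
    by (intro recursive_iter recursive_const recursive_prod_encode recursive_nth recursive_add
        recursive_Suc g) simp_all
  moreover have "codes c \<phi> \<Longrightarrow> codes (rec_nat c ?G n) (Alls (vars K n) \<phi>)" for n c \<phi>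
    by (induction n) (simp_all add: Alls_def codes_Forall)
  ultimately show ?thesis by (intro uniformI[where g = "\<lambda>x. rec_nat (g x) ?G (Suc x)"]) (simp_all only: g)
qed

text \<open>The two sequences are interleaved, \<open>H\<close> at the even and \<open>J\<close> at
  the odd indices.\<close>

lemma uniform_Un:
  assumes "uniform H" "uniform J"
  shows "\<exists>I. uniform I \<and> range I = range H \<union> range J"
proof -
  obtain g h where g: "recursive 1 (\<lambda>xs. g (xs ! 0))" "\<And>n. codes (g n) (H n)"
    and h: "recursive 1 (\<lambda>xs. h (xs ! 0))" "\<And>n. codes (h n) (J n)"
    using assms by (auto simp: uniform_def)
  define I where "I = (\<lambda>x. if x mod 2 = 0 then H (x div 2) else J (x div 2))"
  have half: "recursive 1 (\<lambda>xs. xs ! 0 div 2)"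
    by (intro recursive_div2 recursive_nth) simp
  have "recursive 1 (\<lambda>xs. g (xs ! 0 div 2))" "recursive 1 (\<lambda>xs. h (xs ! 0 div 2))"
    using recursive_comp[of "[\<lambda>xs. xs ! 0 div 2]" "\<lambda>xs. g (xs ! 0)" 1]
      recursive_comp[of "[\<lambda>xs. xs ! 0 div 2]" "\<lambda>xs. h (xs ! 0)" 1] g(1) h(1) half by simp_all
  then have "recursive 1 (\<lambda>xs. if xs ! 0 mod 2 = 0 then g (xs ! 0 div 2) else h (xs ! 0 div 2))"
    by (intro recursive_if recursive_mod2 recursive_nth) simp_all
  then have "uniform I"
    by (rule uniformI) (simp add: I_def g h)
  moreover have "I (2 * n) = H n" "I (Suc (2 * n)) = J n" for n
    by (simp_all add: I_def)
  then have "range H \<union> range J \<subseteq> range I" by (metis UnE image_subsetI rangeI subsetI Un_least)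
  moreover have "range I \<subseteq> range H \<union> range J" by (auto simp: I_def)
  ultimately show ?thesis by blast
qed

lemma uniform_UN:
  assumes "finite C" "C \<noteq> {}" "\<forall>c\<in>C. uniform (H c)"
  shows "\<exists>I. uniform I \<and> range I = (\<Union>c\<in>C. range (H c))"
  using assms
proof (induction C rule: finite_ne_induct)
  case (insert c C)
  then obtain I where "uniform I" "range I = (\<Union>c\<in>C. range (H c))" by auto
  then show ?case using uniform_Un[of "H c" I] insert.prems by simp
qed auto

lemma computable_range:
  assumes "uniform H"
  shows "computable_fm (Disj (acset (range H)))" "computable_fm (Conj (acset (range H)))"
proof -
  obtain g where g: "recursive 1 (\<lambda>xs. g (xs ! 0))" "\<And>n. codes (g n) (H n)"
    using assms by (auto simp: uniform_def)
  then obtain p where "\<And>xs. length xs = 1 \<Longrightarrow> evaluates p xs (g (xs ! 0))"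
    by (auto simp: recursive_def)
  from this[of "[_]"] have p: "ce_set p = range g"
    by (intro ce_set_total) simp
  \<comment> \<open>The rules for codes want the members as a function of their codes, whereas
    \<open>H\<close> is indexed by \<open>n\<close> and \<open>g\<close> need not be injective.
    Since a number codes at most one formula, decoding by choice recovers \<open>H\<close>.\<close>
  define F where "F = (\<lambda>c. SOME \<phi>. codes c \<phi>)"
  have F: "F (g n) = H n" for n
    unfolding F_def using g(2) codes_unique by blast
  then have "F ` ce_set p = range H" "\<forall>c\<in>ce_set p. codes c (F c)"
    using p g(2) by (auto simp: image_image)
  then show "computable_fm (Disj (acset (range H)))" "computable_fm (Conj (acset (range H)))"
    unfolding computable_fm_def using codes_Disj codes_Conj by metis+
qed

lemma computable_UN:
  assumes "finite C" "C \<noteq> {}" "\<forall>c\<in>C. uniform (H c)"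
  shows "computable_fm (Disj (acset (\<Union>c\<in>C. range (H c))))"
    "computable_fm (Conj (acset (\<Union>c\<in>C. range (H c))))"
  using uniform_UN[OF assms] computable_range by metis+

section \<open>Formulas given by clauses\<close>

lemma computable_quantifier_free: "quantifier_free \<phi> \<Longrightarrow> computable_fm \<phi>"
  unfolding computable_fm_def
  by (induction \<phi>)
    (auto intro: codes_Bot codes_Leq codes_Eql codes_Neg codes_And codes_Or)

definition Less :: "nat \<Rightarrow> nat \<Rightarrow> fm" where
  "Less i j = And (Leq i j) (Neg (Eql i j))"

text \<open>The intermediate elements are the values of the \<open>n + 1\<close> variables from
  \<open>K\<close> to \<open>K + n\<close>. An interval is infinite iff it admits such a sequence
  for every \<open>n\<close>.\<close>

definition chain :: "nat \<Rightarrow> nat \<Rightarrow> nat \<Rightarrow> nat \<Rightarrow> fm" where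
  "chain K i j n = And (rec_nat (Less i K) (\<lambda>m \<psi>. And \<psi> (Less (K + m) (K + Suc m))) n) (Less (K + n) j)"

lemma quantifier_free_Less [simp]: "quantifier_free (Less i j)"
  by (simp add: Less_def)

lemma quantifier_free_chain [simp]: "quantifier_free (chain K i j n)"
  unfolding chain_def by (induction n) auto

lemma fv_Less [simp]: "fv (Less i j) = {i, j}"
  by (auto simp: Less_def)

lemma fv_chain: "fv (chain K i j n) \<subseteq> {i, j} \<union> {K..<K + Suc n}"
proof -
  have "fv (rec_nat (Less i K) (\<lambda>m \<psi>. And \<psi> (Less (K + m) (K + Suc m))) n) \<subseteq> {i} \<union> {K..<K + Suc n}"
  proof (induction n)
    case (Suc n)
    have "{K..<K + Suc n} \<subseteq> {K..<K + Suc (Suc n)}" "{K + n, K + Suc n} \<subseteq> {K..<K + Suc (Suc n)}"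
      by simp_all
    with Suc show ?case unfolding nat.rec fv.simps fv_Less by blast
  qed simp
  moreover have "K + n \<in> {K..<K + Suc n}" by simp
  ultimately show ?thesis unfolding chain_def fv.simps fv_Less by blast
qed

lemma uniform_Less:
  "recursive 1 (\<lambda>xs. f (xs ! 0)) \<Longrightarrow> recursive 1 (\<lambda>xs. g (xs ! 0)) \<Longrightarrow> uniform (\<lambda>n. Less (f n) (g n))"
  unfolding Less_def by (intro uniform_And uniform_Leq uniform_Neg uniform_Eql)

lemma uniform_chain: "uniform (chain K i j)"
proof -
  have "uniform (rec_nat (Less i K) (\<lambda>m \<psi>. And \<psi> (Less (K + m) (K + Suc m))))"
    by (intro uniform_rec_And computable_quantifier_free uniform_Less recursive_add recursive_Suc
        recursive_const recursive_nth) simp_all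
  then show ?thesis
    unfolding chain_def
    by (intro uniform_And uniform_Less recursive_add recursive_const recursive_nth) simp_all
qed

text \<open>
  A clause \<open>(g, i, j)\<close> stands for the condition that, for every value of the variable \<open>K\<close> satisfying
  the guard \<open>g\<close>, there are infinitely many elements between the values of \<open>i\<close> and \<open>j\<close>. With \<open>i = j\<close>
  it just says that \<open>g\<close> fails.
\<close>

type_synonym clause = "fm \<times> nat \<times> nat"

fun clause_over :: "nat \<Rightarrow> clause \<Rightarrow> bool" where
  "clause_over K (g, i, j) \<longleftrightarrow> quantifier_free g \<and> fv g \<subseteq> {..K} \<and> i \<le> K \<and> j \<le> K"

text \<open>Levels above 0 are defined for \<open>Disj\<close> and \<open>Conj\<close> only. The
  one-element disjunction makes the part under the universal quantifier Sigma_1, so that the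
  conjunction over all \<open>n\<close> is Pi_2.\<close>

fun clause_Pi :: "nat \<Rightarrow> clause \<Rightarrow> nat \<Rightarrow> fm" where
  "clause_Pi K (g, i, j) n =
    Alls [K] (Disj (acset {Exs (vars (Suc K) (Suc n)) (Or (Neg g) (chain (Suc K) i j n))}))"

fun clause_Sigma :: "nat \<Rightarrow> clause \<Rightarrow> nat \<Rightarrow> fm" where
  "clause_Sigma K (g, i, j) n =
    Exs [K] (Conj (acset {Alls (vars (Suc K) (Suc n)) (And g (Neg (chain (Suc K) i j n)))}))"

definition clauses_Pi :: "nat \<Rightarrow> clause set \<Rightarrow> fm" where
  "clauses_Pi K C = Conj (acset (\<Union>c\<in>C. range (clause_Pi K c)))"

definition clauses_Sigma :: "nat \<Rightarrow> clause set \<Rightarrow> fm" where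
  "clauses_Sigma K C = Disj (acset (\<Union>c\<in>C. range (clause_Sigma K c)))"

text \<open>Every pair \<open>(M, D)\<close> in \<open>J\<close> contributes a negated existence
  statement: each \<open>M\<close>-tuple violates some clause of \<open>D\<close>. The negation of a
  Pi_2 clause is Sigma_2, which keeps the second conjunct Pi_3.\<close>

definition clauses_fm :: "nat \<Rightarrow> clause set \<Rightarrow> (nat \<times> clause set) set \<Rightarrow> fm" where
  "clauses_fm K C J = And (Disj (acset {Exs [0..<K] (clauses_Pi K C)}))
    (Conj (acset ((\<lambda>(M, D). Alls [0..<M] (clauses_Sigma M D)) ` J)))"

lemma uniform_clause_Pi:
  assumes "clause_over K c"
  shows "uniform (clause_Pi K c)"
proof -
  obtain g i j where c: "c = (g, i, j)" by (cases c)
  have "uniform (\<lambda>n. Forall K (Disj (acset {Exs (vars (Suc K) (Suc n)) (Or (Neg g) (chain (Suc K) i j n))})))"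
    using assms c
    by (intro uniform_Forall uniform_Disj_singleton uniform_Exs_vars uniform_Or uniform_chain
        uniform_const computable_quantifier_free) simp
  moreover have "clause_Pi K c = (\<lambda>n. Forall K (Disj (acset {Exs (vars (Suc K) (Suc n)) (Or (Neg g) (chain (Suc K) i j n))})))"
    by (simp add: c Alls_def fun_eq_iff del: vars.simps)
  ultimately show ?thesis by simp
qed

lemma uniform_clause_Sigma:
  assumes "clause_over K c"
  shows "uniform (clause_Sigma K c)"
proof -
  obtain g i j where c: "c = (g, i, j)" by (cases c)
  have "uniform (\<lambda>n. Exists K (Conj (acset {Alls (vars (Suc K) (Suc n)) (And g (Neg (chain (Suc K) i j n)))})))"
    using assms c
    by (intro uniform_Exists uniform_Conj_singleton uniform_Alls_vars uniform_And uniform_Neg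
        uniform_chain uniform_const computable_quantifier_free) simp
  moreover have "clause_Sigma K c = (\<lambda>n. Exists K (Conj (acset {Alls (vars (Suc K) (Suc n)) (And g (Neg (chain (Suc K) i j n)))})))"
    by (simp add: c Exs_def fun_eq_iff del: vars.simps)
  ultimately show ?thesis by simp
qed

lemma computable_clauses:
  assumes "finite C" "C \<noteq> {}" "\<forall>c\<in>C. clause_over K c"
  shows "computable_fm (clauses_Pi K C)" "computable_fm (clauses_Sigma K C)"
  unfolding clauses_Pi_def clauses_Sigma_def
  using assms by (auto intro!: computable_UN uniform_clause_Pi uniform_clause_Sigma)

lemma computable_And: "computable_fm \<phi> \<Longrightarrow> computable_fm \<psi> \<Longrightarrow> computable_fm (And \<phi> \<psi>)"
  unfolding computable_fm_def using codes_And by blast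

lemma computable_Exs: "computable_fm \<phi> \<Longrightarrow> computable_fm (Exs xs \<phi>)"
  unfolding computable_fm_def Exs_def by (induction xs) (auto intro: codes_Exists)

lemma computable_Alls: "computable_fm \<phi> \<Longrightarrow> computable_fm (Alls xs \<phi>)"
  unfolding computable_fm_def Alls_def by (induction xs) (auto intro: codes_Forall)

lemma computable_finite:
  assumes "finite X" "X \<noteq> {}" "\<forall>\<phi>\<in>X. computable_fm \<phi>"
  shows "computable_fm (Disj (acset X))" "computable_fm (Conj (acset X))"
  using computable_UN[of X "\<lambda>\<phi> n. \<phi>"] assms uniform_const by simp_all

lemma rcset_clauses:
  "finite C \<Longrightarrow> rcset (acset (\<Union>c\<in>C. range (H c))) = (\<Union>c\<in>C. range (H c :: nat \<Rightarrow> fm))"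
  by (auto simp: countable_finite)

lemma rcset_finite: "finite X \<Longrightarrow> rcset (acset X) = X"
  by (simp add: countable_finite)

lemma fv_Exs: "fv (Exs xs \<phi>) = fv \<phi> - set xs"
  by (induction xs) (auto simp: Exs_def)

lemma fv_Alls: "fv (Alls xs \<phi>) = fv \<phi> - set xs"
  by (induction xs) (auto simp: Alls_def)

lemma fv_clauses:
  assumes "finite C" "\<forall>c\<in>C. clause_over K c"
  shows "fv (clauses_Pi K C) \<subseteq> {..<K}" "fv (clauses_Sigma K C) \<subseteq> {..<K}"
proof -
  have *: "fv (clause_Pi K c n) \<subseteq> {..<K}" "fv (clause_Sigma K c n) \<subseteq> {..<K}"
    if "c \<in> C" for c n
  proof -
    obtain g i j where c: "c = (g, i, j)" by (cases c)
    then have "fv g \<subseteq> {..K}" "i \<le> K" "j \<le> K" using assms that by force+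
    then show "fv (clause_Pi K c n) \<subseteq> {..<K}" "fv (clause_Sigma K c n) \<subseteq> {..<K}"
      unfolding c using fv_chain[of "Suc K" i j n]
      by (auto simp: fv_Exs fv_Alls rcset_finite set_vars simp del: vars.simps)
  qed
  show "fv (clauses_Pi K C) \<subseteq> {..<K}"
    unfolding clauses_Pi_def fv_Conj rcset_clauses[OF assms(1)] using *(1) by fast
  show "fv (clauses_Sigma K C) \<subseteq> {..<K}"
    unfolding clauses_Sigma_def fv_Disj rcset_clauses[OF assms(1)] using *(2) by fast
qed

lemma is_Sigma_singleton: "is_Pi m \<phi> \<Longrightarrow> m < n \<Longrightarrow> is_Sigma n (Disj (acset {Exs xs \<phi>}))"
  by (rule Sigma_pos) (auto simp: rcset_finite)

lemma is_Pi_singleton: "is_Sigma m \<phi> \<Longrightarrow> m < n \<Longrightarrow> is_Pi n (Conj (acset {Alls xs \<phi>}))"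
  by (rule Pi_pos) (auto simp: rcset_finite)

lemma clauses_Pi_level:
  assumes "finite C" "\<forall>c\<in>C. clause_over K c"
  shows "is_Pi 2 (clauses_Pi K C)"
proof -
  have "\<exists>xs \<phi> m. clause_Pi K c n = Alls xs \<phi> \<and> m < 2 \<and> is_Sigma m \<phi>" if "c \<in> C" for c n
  proof -
    obtain g i j where c: "c = (g, i, j)" by (cases c)
    then have "quantifier_free (Or (Neg g) (chain (Suc K) i j n))" using assms that by auto
    then have "is_Sigma 1 (Disj (acset {Exs (vars (Suc K) (Suc n)) (Or (Neg g) (chain (Suc K) i j n))}))"
      by (rule is_Sigma_singleton[OF Pi_0]) simp
    then show ?thesis unfolding c clause_Pi.simps using one_less_numeral_iff semiring_norm(76) by blast
  qed
  then show ?thesis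
    unfolding clauses_Pi_def by (intro Pi_pos) (auto simp: rcset_clauses[OF assms(1)])
qed

lemma clauses_Sigma_level:
  assumes "finite C" "\<forall>c\<in>C. clause_over K c"
  shows "is_Sigma 2 (clauses_Sigma K C)"
proof -
  have "\<exists>xs \<phi> m. clause_Sigma K c n = Exs xs \<phi> \<and> m < 2 \<and> is_Pi m \<phi>" if "c \<in> C" for c n
  proof -
    obtain g i j where c: "c = (g, i, j)" by (cases c)
    then have "quantifier_free (And g (Neg (chain (Suc K) i j n)))" using assms that by auto
    then have "is_Pi 1 (Conj (acset {Alls (vars (Suc K) (Suc n)) (And g (Neg (chain (Suc K) i j n)))}))"
      by (rule is_Pi_singleton[OF Sigma_0]) simp
    then show ?thesis unfolding c clause_Sigma.simps using one_less_numeral_iff semiring_norm(76) by blast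
  qed
  then show ?thesis
    unfolding clauses_Sigma_def by (intro Sigma_pos) (auto simp: rcset_clauses[OF assms(1)])
qed

lemma
  assumes "finite C" "C \<noteq> {}" "\<forall>c\<in>C. clause_over K c"
    and "finite J" "J \<noteq> {}" "\<forall>(M, D)\<in>J. finite D \<and> D \<noteq> {} \<and> (\<forall>c\<in>D. clause_over M c)"
  shows computable_clauses_fm: "computable_fm (clauses_fm K C J)"
    and is_d_Sigma_clauses_fm: "is_d_Sigma 3 (clauses_fm K C J)"
    and sentence_clauses_fm: "sentence (clauses_fm K C J)"
proof -
  show "computable_fm (clauses_fm K C J)"
    unfolding clauses_fm_def using assms
    by (intro computable_And computable_finite) (auto intro!: computable_Exs computable_Alls computable_clauses)
  have "is_Sigma 3 (Disj (acset {Exs [0..<K] (clauses_Pi K C)}))"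
    by (rule is_Sigma_singleton[OF clauses_Pi_level[OF assms(1,3)]]) simp
  moreover have "is_Pi 3 (Conj (acset ((\<lambda>(M, D). Alls [0..<M] (clauses_Sigma M D)) ` J)))"
  proof (intro Pi_pos)
    have "\<exists>xs \<phi> m. Alls [0..<M] (clauses_Sigma M D) = Alls xs \<phi> \<and> m < 3 \<and> is_Sigma m \<phi>"
      if "(M, D) \<in> J" for M D
      using clauses_Sigma_level[of D M] assms(6) that
      by (intro exI[of _ "[0..<M]"] exI[of _ "clauses_Sigma M D"] exI[of _ "2::nat"]) auto
    then show "\<forall>\<psi>\<in>rcset (acset ((\<lambda>(M, D). Alls [0..<M] (clauses_Sigma M D)) ` J)).
        \<exists>xs \<phi> m. \<psi> = Alls xs \<phi> \<and> m < 3 \<and> is_Sigma m \<phi>"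
      using assms(4) by (auto simp: rcset_finite)
  qed simp
  ultimately show "is_d_Sigma 3 (clauses_fm K C J)"
    unfolding is_d_Sigma_def clauses_fm_def by blast
  have "fv (Alls [0..<M] (clauses_Sigma M D)) = {}" if "(M, D) \<in> J" for M D
  proof -
    have "finite D" "\<forall>c\<in>D. clause_over M c" using assms(6) that by auto
    then have "fv (clauses_Sigma M D) \<subseteq> {..<M}" by (rule fv_clauses(2))
    then show ?thesis by (auto simp: fv_Alls)
  qed
  moreover have "fv (Exs [0..<K] (clauses_Pi K C)) = {}"
    using fv_clauses(1)[OF assms(1,3)] by (auto simp: fv_Exs)
  ultimately show "sentence (clauses_fm K C J)"
    using assms(4) by (auto simp: sentence_def clauses_fm_def rcset_finite)
qed

lemma sat_Exs:
  "sat A r (Exs xs \<phi>) e \<longleftrightarrow>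
    (\<exists>e'. (\<forall>i\<in>set xs. e' i \<in> A) \<and> (\<forall>i. i \<notin> set xs \<longrightarrow> e' i = e i) \<and> sat A r \<phi> e')"
proof (induction xs arbitrary: e)
  case Nil
  have "(\<forall>i. e' i = e i) \<longleftrightarrow> e' = e" for e' by auto
  then show ?case by (simp add: Exs_def)
next
  case (Cons x xs)
  have "sat A r (Exs (x # xs) \<phi>) e \<longleftrightarrow> (\<exists>a\<in>A. sat A r (Exs xs \<phi>) (e(x := a)))"
    by (simp add: Exs_def)
  also have "\<dots> \<longleftrightarrow> (\<exists>e'. (\<forall>i\<in>set (x # xs). e' i \<in> A) \<and> (\<forall>i. i \<notin> set (x # xs) \<longrightarrow> e' i = e i) \<and> sat A r \<phi> e')"
  proof
    assume "\<exists>a\<in>A. sat A r (Exs xs \<phi>) (e(x := a))"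
    then obtain a e' where "a \<in> A" "\<forall>i\<in>set xs. e' i \<in> A" "\<forall>i. i \<notin> set xs \<longrightarrow> e' i = (e(x := a)) i"
      "sat A r \<phi> e'"
      unfolding Cons.IH by blast
    then show "\<exists>e'. (\<forall>i\<in>set (x # xs). e' i \<in> A) \<and> (\<forall>i. i \<notin> set (x # xs) \<longrightarrow> e' i = e i) \<and> sat A r \<phi> e'"
      by (intro exI[of _ e'] conjI) (simp_all, metis fun_upd_same)
  next
    assume "\<exists>e'. (\<forall>i\<in>set (x # xs). e' i \<in> A) \<and> (\<forall>i. i \<notin> set (x # xs) \<longrightarrow> e' i = e i) \<and> sat A r \<phi> e'"
    then obtain e' where "\<forall>i\<in>set (x # xs). e' i \<in> A" "\<forall>i. i \<notin> set (x # xs) \<longrightarrow> e' i = e i" "sat A r \<phi> e'"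
      by blast
    then show "\<exists>a\<in>A. sat A r (Exs xs \<phi>) (e(x := a))"
      unfolding Cons.IH by (intro bexI[of _ "e' x"] exI[of _ e']) auto
  qed
  finally show ?case .
qed

lemma sat_Alls: "sat A r (Alls xs \<phi>) e \<longleftrightarrow> \<not> sat A r (Exs xs (Neg \<phi>)) e"
  by (induction xs arbitrary: e) (simp_all add: Alls_def Exs_def)

section \<open>Satisfaction of clauses in linear orders\<close>

definition less_in :: "'a rel \<Rightarrow> 'a \<Rightarrow> 'a \<Rightarrow> bool" where
  "less_in r x y \<longleftrightarrow> (x, y) \<in> r \<and> x \<noteq> y"

definition between :: "'a set \<Rightarrow> 'a rel \<Rightarrow> 'a \<Rightarrow> 'a \<Rightarrow> 'a set" where
  "between A r x y = {z\<in>A. less_in r x z \<and> less_in r z y}"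

lemma sat_Less [simp]: "sat A r (Less i j) e \<longleftrightarrow> less_in r (e i) (e j)"
  by (simp add: Less_def less_in_def)

lemma sat_chain:
  "sat A r (chain K i j n) e \<longleftrightarrow> less_in r (e i) (e K) \<and>
    (\<forall>m<n. less_in r (e (K + m)) (e (K + Suc m))) \<and> less_in r (e (K + n)) (e j)"
proof -
  have "sat A r (rec_nat (Less i K) (\<lambda>m \<psi>. And \<psi> (Less (K + m) (K + Suc m))) n) e \<longleftrightarrow>
      less_in r (e i) (e K) \<and> (\<forall>m<n. less_in r (e (K + m)) (e (K + Suc m)))"
    by (induction n) (auto simp: less_Suc_eq)
  then show ?thesis by (simp add: chain_def)
qed

lemma sat_singleton [simp]:
  "sat A r (Disj (acset {\<phi>})) e \<longleftrightarrow> sat A r \<phi> e" "sat A r (Conj (acset {\<phi>})) e \<longleftrightarrow> sat A r \<phi> e"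
  by (simp_all add: rcset_finite)

text \<open>The two forms of a clause are De Morgan duals, so satisfaction has to be analysed for
  \<open>clause_Pi\<close> only.\<close>

lemma sat_clause_Sigma: "sat A r (clause_Sigma K c n) e \<longleftrightarrow> \<not> sat A r (clause_Pi K c n) e"
proof -
  obtain g i j where "c = (g, i, j)" by (cases c)
  then have "sat A r (clause_Sigma K c n) e \<longleftrightarrow>
      \<not> (\<forall>a\<in>A. \<not> sat A r (Alls (vars (Suc K) (Suc n)) (And g (Neg (chain (Suc K) i j n)))) (e(K := a)))"
    by (simp add: Exs_def[of "[K]"] del: vars.simps)
  also have "\<dots> \<longleftrightarrow> \<not> (\<forall>a\<in>A. sat A r (Exs (vars (Suc K) (Suc n)) (Or (Neg g) (chain (Suc K) i j n))) (e(K := a)))"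
    unfolding sat_Alls sat_Exs by simp
  also have "\<dots> \<longleftrightarrow> \<not> sat A r (clause_Pi K c n) e"
    using \<open>c = _\<close> by (simp add: Alls_def[of "[K]"] del: vars.simps)
  finally show ?thesis .
qed

lemma sat_clauses_Pi:
  "finite C \<Longrightarrow> sat A r (clauses_Pi K C) e \<longleftrightarrow> (\<forall>c\<in>C. \<forall>n. sat A r (clause_Pi K c n) e)"
  unfolding clauses_Pi_def sat_Conj by (subst rcset_clauses) auto

lemma sat_clauses_Sigma:
  "finite C \<Longrightarrow> sat A r (clauses_Sigma K C) e \<longleftrightarrow> (\<exists>c\<in>C. \<exists>n. \<not> sat A r (clause_Pi K c n) e)"
  unfolding clauses_Sigma_def sat_Disj by (subst rcset_clauses) (auto simp: sat_clause_Sigma)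

definition ascending :: "'a set \<Rightarrow> 'a rel \<Rightarrow> 'a \<Rightarrow> 'a \<Rightarrow> nat \<Rightarrow> (nat \<Rightarrow> 'a) \<Rightarrow> bool" where
  "ascending A r x y n f \<longleftrightarrow> (\<forall>m\<le>n. f m \<in> A) \<and> less_in r x (f 0) \<and>
    (\<forall>m<n. less_in r (f m) (f (Suc m))) \<and> less_in r (f n) y"

lemma sat_Exs_chain:
  assumes g: "fv g \<subseteq> {..K}" and ij: "i \<le> K" "j \<le> K" and K: "d K \<in> A"
  shows "sat A r (Exs (vars (Suc K) (Suc n)) (Or (Neg g) (chain (Suc K) i j n))) d \<longleftrightarrow>
    (sat A r g d \<longrightarrow> (\<exists>f. ascending A r (d i) (d j) n f))" (is "?L \<longleftrightarrow> ?R")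
proof
  assume ?L
  then obtain d' where d': "\<forall>m\<in>set (vars (Suc K) (Suc n)). d' m \<in> A"
    "\<forall>m. m \<notin> set (vars (Suc K) (Suc n)) \<longrightarrow> d' m = d m"
    "sat A r (Or (Neg g) (chain (Suc K) i j n)) d'"
    unfolding sat_Exs by blast
  have *: "d' m = d m" if "m \<le> K" for m using d'(2) that by (simp add: set_vars del: vars.simps)
  then have "sat A r g d' = sat A r g d" using g by (intro sat_fv_cong) auto
  moreover have "ascending A r (d i) (d j) n (\<lambda>m. d' (Suc K + m))"
    if "sat A r (chain (Suc K) i j n) d'"
    unfolding ascending_def
  proof (intro conjI allI impI)
    show "d' (Suc K + m) \<in> A" if "m \<le> n" for m
      using d'(1) that by (simp add: set_vars del: vars.simps)
    show "less_in r (d i) (d' (Suc K + 0))" "less_in r (d' (Suc K + n)) (d j)"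
      using that[unfolded sat_chain] unfolding *[OF ij(1)] *[OF ij(2)] add_0_right by blast+
    show "less_in r (d' (Suc K + m)) (d' (Suc K + Suc m))" if "m < n" for m
      using \<open>sat A r (chain (Suc K) i j n) d'\<close>[unfolded sat_chain] that by blast
  qed
  ultimately show ?R using d'(3) unfolding sat.simps(4,6) by blast
next
  assume R: ?R
  obtain f where f: "\<forall>m\<le>n. f m \<in> A" "sat A r g d \<longrightarrow> ascending A r (d i) (d j) n f"
  proof (cases "sat A r g d")
    case True
    then show ?thesis using R that unfolding ascending_def by blast
  next
    case False
    \<comment> \<open>If the guard fails, the existential quantifiers in front of the disjunction
      still need values in \<open>A\<close>; the value of the variable \<open>K\<close> is
      one.\<close>
    then show ?thesis using K that[of "\<lambda>_. d K"] by simp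
  qed
  define d' where "d' = (\<lambda>m. if m \<in> {Suc K..<Suc K + Suc n} then f (m - Suc K) else d m)"
  have *: "d' m = d m" if "m \<le> K" for m using that by (simp add: d'_def)
  have **: "d' (Suc K + m) = f m" if "m \<le> n" for m using that by (simp add: d'_def)
  have "sat A r g d' = sat A r g d" using g * by (intro sat_fv_cong) auto
  moreover have "sat A r (chain (Suc K) i j n) d'" if "ascending A r (d i) (d j) n f"
    unfolding sat_chain
  proof (intro conjI allI impI)
    show "less_in r (d' i) (d' (Suc K))" "less_in r (d' (Suc K + n)) (d' j)"
      using that *[OF ij(1)] *[OF ij(2)] **[of 0] **[of n] by (simp_all add: ascending_def)
    show "less_in r (d' (Suc K + m)) (d' (Suc K + Suc m))" if "m < n" for m
      using \<open>ascending A r (d i) (d j) n f\<close> that **[of m] **[of "Suc m"] by (simp add: ascending_def)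
  qed
  ultimately have "sat A r (Or (Neg g) (chain (Suc K) i j n)) d'"
    using f(2) unfolding sat.simps(4,6) by blast
  moreover have "\<forall>m\<in>{Suc K..<Suc K + Suc n}. d' m \<in> A"
    using f(1) by (auto simp: d'_def)
  moreover have "\<forall>m. m \<notin> {Suc K..<Suc K + Suc n} \<longrightarrow> d' m = d m" by (simp add: d'_def)
  ultimately show ?L unfolding sat_Exs set_vars by blast
qed

lemma sat_clause_Pi:
  assumes "clause_over K (g, i, j)"
  shows "sat A r (clause_Pi K (g, i, j) n) e \<longleftrightarrow>
    (\<forall>a\<in>A. sat A r g (e(K := a)) \<longrightarrow>
      (\<exists>f. ascending A r ((e(K := a)) i) ((e(K := a)) j) n f))"
proof -
  have "sat A r (clause_Pi K (g, i, j) n) e \<longleftrightarrow>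
    (\<forall>a\<in>A. sat A r (Exs (vars (Suc K) (Suc n)) (Or (Neg g) (chain (Suc K) i j n))) (e(K := a)))"
    by (simp add: Alls_def del: vars.simps)
  also have "\<dots> \<longleftrightarrow> (\<forall>a\<in>A. sat A r g (e(K := a)) \<longrightarrow>
      (\<exists>f. ascending A r ((e(K := a)) i) ((e(K := a)) j) n f))"
    using assms by (intro ball_cong refl sat_Exs_chain) simp_all
  finally show ?thesis .
qed

definition clause_holds :: "'a set \<Rightarrow> 'a rel \<Rightarrow> nat \<Rightarrow> clause \<Rightarrow> (nat \<Rightarrow> 'a) \<Rightarrow> bool" where
  "clause_holds A r K = (\<lambda>(g, i, j) e. \<forall>a\<in>A. sat A r g (e(K := a)) \<longrightarrow>
    infinite (between A r ((e(K := a)) i) ((e(K := a)) j)))"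

lemma all_sat_Alls:
  "(\<forall>e. sat A r (Alls [0..<M] \<phi>) e) \<longleftrightarrow> (\<forall>e. (\<forall>i<M. e i \<in> A) \<longrightarrow> sat A r \<phi> e)"
proof
  assume "\<forall>e. sat A r (Alls [0..<M] \<phi>) e"
  then show "\<forall>e. (\<forall>i<M. e i \<in> A) \<longrightarrow> sat A r \<phi> e"
    unfolding sat_Alls sat_Exs by (simp, metis atLeastLessThan_iff)
next
  assume "\<forall>e. (\<forall>i<M. e i \<in> A) \<longrightarrow> sat A r \<phi> e"
  then show "\<forall>e. sat A r (Alls [0..<M] \<phi>) e"
    unfolding sat_Alls sat_Exs by auto
qed

locale linear_order_set =
  fixes A :: "'a set" and r :: "'a rel"
  assumes lin: "linear_order_on A r"
begin

abbreviation lt (infix "\<sqsubset>" 50) where "x \<sqsubset> y \<equiv> less_in r x y"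

lemma rel_iff: "(x, y) \<in> r \<longleftrightarrow> x \<sqsubset> y \<or> x = y \<and> x \<in> A"
  using lin unfolding less_in_def order_on_defs refl_on_def by auto

lemma lt_irrefl [simp]: "\<not> x \<sqsubset> x"
  by (simp add: less_in_def)

lemma lt_trans [trans]: "x \<sqsubset> y \<Longrightarrow> y \<sqsubset> z \<Longrightarrow> x \<sqsubset> z"
  using lin unfolding less_in_def order_on_defs by (meson antisymD transD)

lemma lt_asym: "x \<sqsubset> y \<Longrightarrow> \<not> y \<sqsubset> x"
  using lt_trans lt_irrefl by blast

lemma lt_total: "x \<in> A \<Longrightarrow> y \<in> A \<Longrightarrow> x \<sqsubset> y \<or> x = y \<or> y \<sqsubset> x"
  using lin unfolding less_in_def order_on_defs total_on_def by blast

lemma lt_carrier: "x \<sqsubset> y \<Longrightarrow> x \<in> A" "x \<sqsubset> y \<Longrightarrow> y \<in> A"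
  using lin unfolding less_in_def order_on_defs by auto

lemma between_self [simp]: "between A r x x = {}"
  using lt_asym by (auto simp: between_def)

text \<open>Number each element of \<open>S\<close> by how many elements of \<open>S\<close> lie
  below it; the enumeration is the inverse of this map.\<close>

lemma increasing_enumeration:
  assumes "finite S" "S \<subseteq> A"
  shows "\<exists>f. bij_betw f {..<card S} S \<and> (\<forall>i j. i < j \<longrightarrow> j < card S \<longrightarrow> f i \<sqsubset> f j)"
proof -
  define h where "h x = card {y\<in>S. y \<sqsubset> x}" for x
  have mono: "h x < h y" if "x \<in> S" "x \<sqsubset> y" for x y
  proof -
    have "{z\<in>S. z \<sqsubset> x} \<subseteq> {z\<in>S. z \<sqsubset> y}" "x \<in> {z\<in>S. z \<sqsubset> y} - {z\<in>S. z \<sqsubset> x}"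
      using that lt_trans by auto
    then have "{z\<in>S. z \<sqsubset> x} \<subset> {z\<in>S. z \<sqsubset> y}" by blast
    then show ?thesis
      unfolding h_def using assms(1) by (intro psubset_card_mono) auto
  qed
  have "inj_on h S"
    using mono lt_total assms(2) by (intro inj_onI) (metis less_irrefl subsetD)
  moreover have "h x < card S" if "x \<in> S" for x
  proof -
    have "{y\<in>S. y \<sqsubset> x} \<subset> S" using that lt_irrefl by blast
    then show ?thesis unfolding h_def using assms(1) by (intro psubset_card_mono)
  qed
  then have "h ` S \<subseteq> {..<card S}" by auto
  ultimately have h: "bij_betw h S {..<card S}"
    by (simp add: bij_betw_def card_image card_subset_eq)
  define f where "f = inv_into S h"
  have f: "bij_betw f {..<card S} S" unfolding f_def using h by (rule bij_betw_inv_into)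
  have hf: "h (f i) = i" if "i < card S" for i
    unfolding f_def using h that by (simp add: bij_betw_inv_into_right)
  have "f i \<sqsubset> f j" if "i < j" "j < card S" for i j
  proof (rule ccontr)
    have S: "f i \<in> S" "f j \<in> S" using f that by (auto simp: bij_betw_def)
    assume "\<not> f i \<sqsubset> f j"
    then have "f i = f j \<or> f j \<sqsubset> f i" using lt_total S assms(2) by blast
    then have "h (f j) \<le> h (f i)" using mono S by (auto intro: less_imp_le)
    then show False using hf that by simp
  qed
  then show ?thesis using f by blast
qed

lemma ascending_iff_infinite:
  "(\<forall>n. \<exists>f. ascending A r x y n f) \<longleftrightarrow>
    infinite (between A r x y)" (is "?L \<longleftrightarrow> ?R")
proof
  assume L: ?L
  show ?R
  proof
    assume fin: "finite (between A r x y)"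
    \<comment> \<open>An ascending sequence with parameter \<open>n\<close> has \<open>n + 1\<close>
      terms, so this choice gives one element too many.\<close>
    define n where "n = card (between A r x y)"
    obtain f where f: "\<forall>m\<le>n. f m \<in> A" "x \<sqsubset> f 0" "\<forall>m<n. f m \<sqsubset> f (Suc m)" "f n \<sqsubset> y"
      using L unfolding ascending_def by blast
    have mono: "f m \<sqsubset> f m'" if "m < m'" "m' \<le> n" for m m'
      using that
    proof (induction m')
      case (Suc m')
      then show ?case using f(3) lt_trans[of "f m" "f m'"] by (auto simp: less_Suc_eq)
    qed simp
    then have "inj_on f {..n}" by (metis atMost_iff inj_onI lt_irrefl nat_neq_iff)
    moreover have "f ` {..n} \<subseteq> between A r x y"
    proof
      fix z assume "z \<in> f ` {..n}"
      then obtain m where m: "z = f m" "m \<le> n" by auto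
      have "x \<sqsubset> f m" using mono[of 0 m] f(2) m(2) lt_trans by (cases m) auto
      moreover have "f m \<sqsubset> y" using mono[of m n] f(4) m(2) lt_trans by (cases "m = n") auto
      ultimately show "z \<in> between A r x y" using f(1) m by (simp add: between_def)
    qed
    ultimately have "card {..n} \<le> card (between A r x y)" using fin card_inj_on_le by blast
    then show False by (simp add: n_def)
  qed
next
  assume inf: ?R
  show ?L
  proof
    fix n
    obtain T where T: "T \<subseteq> between A r x y" "finite T" "card T = Suc n"
      using infinite_arbitrarily_large[OF inf] by metis
    then obtain f where f: "bij_betw f {..<Suc n} T" "\<forall>i j. i < j \<longrightarrow> j < Suc n \<longrightarrow> f i \<sqsubset> f j"
      using increasing_enumeration[of T] by (auto simp: between_def)
    have "f m \<in> between A r x y" if "m \<le> n" for m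
      using f(1) T(1) that by (auto simp: bij_betw_def)
    then show "\<exists>f. ascending A r x y n f"
      using f(2) by (intro exI[of _ f]) (auto simp: between_def ascending_def)
  qed
qed

lemma clause_holds_iff:
  assumes "clause_over K c"
  shows "(\<forall>n. sat A r (clause_Pi K c n) e) \<longleftrightarrow> clause_holds A r K c e"
proof -
  obtain g i j where c: "c = (g, i, j)" by (cases c)
  show ?thesis
    unfolding c sat_clause_Pi[OF assms[unfolded c]] clause_holds_def prod.case
      ascending_iff_infinite[symmetric] by blast
qed

lemma models_clauses_fm:
  assumes "finite C" "\<forall>c\<in>C. clause_over K c"
    and "finite J" "\<forall>(M, D)\<in>J. finite D \<and> (\<forall>c\<in>D. clause_over M c)"
  shows "models A r (clauses_fm K C J) \<longleftrightarrow>
    (\<exists>e. (\<forall>i<K. e i \<in> A) \<and> (\<forall>c\<in>C. clause_holds A r K c e)) \<and>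
    (\<forall>(M, D)\<in>J. \<forall>e. (\<forall>i<M. e i \<in> A) \<longrightarrow> (\<exists>c\<in>D. \<not> clause_holds A r M c e))"
proof -
  have Pi: "sat A r (clauses_Pi K C) e \<longleftrightarrow> (\<forall>c\<in>C. clause_holds A r K c e)" for e
    using clause_holds_iff assms(2) by (simp add: sat_clauses_Pi[OF assms(1)])
  have Sigma: "sat A r (clauses_Sigma M D) e \<longleftrightarrow> (\<exists>c\<in>D. \<not> clause_holds A r M c e)"
    if "(M, D) \<in> J" for M D e
  proof -
    have D: "finite D" "\<forall>c\<in>D. clause_over M c" using assms(4) that by auto
    then have "(\<exists>n. \<not> sat A r (clause_Pi M c n) e) \<longleftrightarrow> \<not> clause_holds A r M c e" if "c \<in> D" for c
      using clause_holds_iff[of M c e] that by blast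
    then show ?thesis unfolding sat_clauses_Sigma[OF D(1)] by blast
  qed
  \<comment> \<open>\<open>models\<close> ranges over all assignments, but the formula has no free
    variables, so satisfaction under one assignment is enough.\<close>
  have "(\<forall>e. sat A r (Exs [0..<K] (clauses_Pi K C)) e) \<longleftrightarrow>
      (\<exists>e. (\<forall>i<K. e i \<in> A) \<and> sat A r (clauses_Pi K C) e)"
  proof
    assume "\<exists>e. (\<forall>i<K. e i \<in> A) \<and> sat A r (clauses_Pi K C) e"
    then obtain e where "\<forall>i<K. e i \<in> A" "sat A r (clauses_Pi K C) e" by blast
    then have "sat A r (Exs [0..<K] (clauses_Pi K C)) e"
      unfolding sat_Exs by (intro exI[of _ e]) simp
    moreover have "fv (Exs [0..<K] (clauses_Pi K C)) = {}"
      using fv_clauses(1)[OF assms(1,2)] by (auto simp: fv_Exs)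
    ultimately show "\<forall>e. sat A r (Exs [0..<K] (clauses_Pi K C)) e"
      using sat_fv_cong by blast
  next
    assume "\<forall>e. sat A r (Exs [0..<K] (clauses_Pi K C)) e"
    then have "sat A r (Exs [0..<K] (clauses_Pi K C)) undefined" by blast
    then obtain e where "\<forall>i\<in>set [0..<K]. e i \<in> A" "sat A r (clauses_Pi K C) e"
      unfolding sat_Exs by blast
    then show "\<exists>e. (\<forall>i<K. e i \<in> A) \<and> sat A r (clauses_Pi K C) e"
      by (intro exI[of _ e]) simp
  qed
  then have "models A r (clauses_fm K C J) \<longleftrightarrow> (\<exists>e. (\<forall>i<K. e i \<in> A) \<and> sat A r (clauses_Pi K C) e) \<and>
      (\<forall>(M, D)\<in>J. \<forall>e. sat A r (Alls [0..<M] (clauses_Sigma M D)) e)"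
    unfolding models_def clauses_fm_def sat.simps(5) sat_singleton sat_Conj
      rcset_finite[OF finite_imageI[OF assms(3)]] split_beta all_conj_distrib ball_simps
    by blast
  moreover have "(\<forall>(M, D)\<in>J. \<forall>e. sat A r (Alls [0..<M] (clauses_Sigma M D)) e) \<longleftrightarrow>
      (\<forall>(M, D)\<in>J. \<forall>e. (\<forall>i<M. e i \<in> A) \<longrightarrow> (\<exists>c\<in>D. \<not> clause_holds A r M c e))"
    unfolding all_sat_Alls by (intro ball_cong refl) (clarsimp simp: Sigma)
  ultimately show ?thesis unfolding Pi by (rule trans[OF _ arg_cong2[where f = "(\<and>)", OF refl]])
qed

end

text \<open>The guard collects the axioms of linear orders for the variables 0, 1, 2. The clause
  holds if its guard fails for all values of the variable 3, which does not occur in the guard.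
  Placed in \<open>J\<close>, where clauses must be violated, it thus asserts the axioms for every
  triple.\<close>

definition linear_order_clause :: clause where
  "linear_order_clause = (And (And (Leq 0 0) (Or (Leq 0 1) (Leq 1 0)))
    (And (Or (Eql 0 1) (Neg (And (Leq 0 1) (Leq 1 0))))
      (Or (Leq 0 2) (Neg (And (Leq 0 1) (Leq 1 2))))), 0, 0)"

text \<open>A Scott sentence is tested on arbitrary binary relations, so it must itself enforce a
  linear order. The reading of clauses by infinite intervals is available only afterwards, hence the
  argument works with \<open>clause_Pi\<close> directly.\<close>

lemma linear_order_if_models:
  assumes "s \<subseteq> B \<times> B" "models B s (clauses_fm K C J)" "finite J" "(3, {linear_order_clause}) \<in> J"
  shows "linear_order_on B s"
proof -
  define g where "g = fst linear_order_clause"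
  have c: "linear_order_clause = (g, 0, 0)" by (simp add: g_def linear_order_clause_def)
  have over: "clause_over 3 (g, 0, 0)" unfolding c[symmetric] by (auto simp: linear_order_clause_def)
  have "fv g \<subseteq> {..<3}" by (auto simp: g_def linear_order_clause_def)
  have "\<forall>e. sat B s (Alls [0..<3] (clauses_Sigma 3 {linear_order_clause})) e"
    using assms(2-4) by (auto simp: models_def clauses_fm_def rcset_finite)
  then have *: "sat B s (clauses_Sigma 3 {linear_order_clause}) e" if "\<forall>i<3. e i \<in> B" for e
    using that unfolding all_sat_Alls by blast
  have sat: "sat B s g e" if e: "\<forall>i<3. e i \<in> B" for e
  proof -
    obtain a where "sat B s g (e(3 := a))"
      using *[OF e] sat_clause_Pi[OF over, of B s _ e] by (auto simp: sat_clauses_Sigma c simp del: clause_Pi.simps)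
    moreover have "\<forall>i\<in>fv g. e i = (e(3 := a)) i" using \<open>fv g \<subseteq> {..<3}\<close> by auto
    ultimately show ?thesis using sat_fv_cong[of g e "e(3 := a)"] by blast
  qed
  have ax: "(x, x) \<in> s \<and> ((x, y) \<in> s \<or> (y, x) \<in> s) \<and> ((x, y) \<in> s \<longrightarrow> x = y \<or> (y, x) \<notin> s) \<and>
      ((x, y) \<in> s \<longrightarrow> (x, z) \<in> s \<or> (y, z) \<notin> s)" if "x \<in> B" "y \<in> B" "z \<in> B" for x y z
    using sat[of "\<lambda>i. if i = 0 then x else if i = 1 then y else z"] that
    by (auto simp: g_def linear_order_clause_def)
  show ?thesis
    unfolding order_on_defs refl_on_def total_on_def
  proof (intro conjI ballI impI transI antisymI)
    show "s \<subseteq> B \<times> B" by fact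
    show "(x, x) \<in> s" if "x \<in> B" for x using ax that by blast
    show "(x, z) \<in> s" if "(x, y) \<in> s" "(y, z) \<in> s" for x y z using ax[of x y z] that assms(1) by blast
    show "x = y" if "(x, y) \<in> s" "(y, x) \<in> s" for x y using ax[of x y x] that assms(1) by blast
    show "(x, y) \<in> s \<or> (y, x) \<in> s" if "x \<in> B" "y \<in> B" for x y using ax that by blast
  qed
qed

section \<open>The sentence describing a sequence of blocks\<close>

text \<open>This is the property of being first in one's block, in a form that a single clause can
  express.\<close>

definition block_min :: "'a set \<Rightarrow> 'a rel \<Rightarrow> 'a \<Rightarrow> bool" where
  "block_min A r x \<longleftrightarrow> (\<forall>y\<in>A. less_in r y x \<longrightarrow> infinite (between A r y x))"

definition block_max :: "'a set \<Rightarrow> 'a rel \<Rightarrow> 'a \<Rightarrow> bool" where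
  "block_max A r x \<longleftrightarrow> (\<forall>y\<in>A. less_in r x y \<longrightarrow> infinite (between A r x y))"

text \<open>The points \<open>a i 0\<close>, ..., \<open>a i (n i)\<close> lie consecutively in the
  \<open>i\<close>-th block. The flags \<open>lo i\<close> and \<open>hi i\<close> tell whether this
  block has a first and a last element, which are then the two ends of the listed points; if both
  are set, the block has exactly \<open>n i + 1\<close> elements. An infinite interval from
  \<open>a i 0\<close> to \<open>a (Suc i) 0\<close> also puts these two points in the right
  order.\<close>

definition shape_witness ::
  "'a set \<Rightarrow> 'a rel \<Rightarrow> nat \<Rightarrow> (nat \<Rightarrow> nat) \<Rightarrow> (nat \<Rightarrow> bool) \<Rightarrow> (nat \<Rightarrow> bool) \<Rightarrow> (nat \<Rightarrow> nat \<Rightarrow> 'a) \<Rightarrow> bool" where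
  "shape_witness A r k n lo hi a \<longleftrightarrow>
    (\<forall>i<k. \<forall>j\<le>n i. a i j \<in> A) \<and>
    (\<forall>i<k. \<forall>j<n i. less_in r (a i j) (a i (Suc j)) \<and> between A r (a i j) (a i (Suc j)) = {}) \<and>
    (\<forall>i. Suc i < k \<longrightarrow> infinite (between A r (a i 0) (a (Suc i) 0))) \<and>
    (\<forall>i<k. lo i \<longrightarrow> block_min A r (a i 0)) \<and>
    (\<forall>i<k. hi i \<longrightarrow> block_max A r (a i (n i)))"

text \<open>The order condition on the pair is essential, because the interval from a larger to a
  smaller element is empty and hence finite. A repeated value counts as a near pair.\<close>

definition at_most_blocks :: "'a set \<Rightarrow> 'a rel \<Rightarrow> nat \<Rightarrow> bool" where
  "at_most_blocks A r k \<longleftrightarrow> (\<forall>y. (\<forall>i\<le>k. y i \<in> A) \<longrightarrow>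
    (\<exists>i\<le>k. \<exists>j\<le>k. i \<noteq> j \<and> (y i, y j) \<in> r \<and> finite (between A r (y i) (y j))))"

definition at_most_points :: "'a set \<Rightarrow> ('a \<Rightarrow> bool) \<Rightarrow> nat \<Rightarrow> bool" where
  "at_most_points A P m \<longleftrightarrow> (\<forall>y. (\<forall>i\<le>m. y i \<in> A) \<longrightarrow>
    (\<exists>j\<le>m. \<exists>i<j. y i = y j) \<or> (\<exists>i\<le>m. \<not> P (y i)))"

abbreviation var :: "nat \<Rightarrow> nat \<Rightarrow> nat" where
  "var i j \<equiv> prod_encode (i, j)"

text \<open>The trivially true clause \<open>(Bot, 0, 0)\<close> only serves to make the sets of clauses nonempty.\<close>

definition witness_clauses ::
  "nat \<Rightarrow> nat \<Rightarrow> (nat \<Rightarrow> nat) \<Rightarrow> (nat \<Rightarrow> bool) \<Rightarrow> (nat \<Rightarrow> bool) \<Rightarrow> clause set" where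
  "witness_clauses K k n lo hi = insert (Bot, 0, 0)
    ((\<Union>i<k. (\<lambda>j. (Neg (Less (var i j) (var i (Suc j))), 0, 0)) ` {..<n i}) \<union>
     (\<Union>i<k. (\<lambda>j. (And (Less (var i j) K) (Less K (var i (Suc j))), 0, 0)) ` {..<n i}) \<union>
     (\<lambda>i. (Neg Bot, var i 0, var (Suc i) 0)) ` {..<k - 1} \<union>
     (\<lambda>i. (Less K (var i 0), K, var i 0)) ` {i. i < k \<and> lo i} \<union>
     (\<lambda>i. (Less (var i (n i)) K, var i (n i), K)) ` {i. i < k \<and> hi i})"

definition block_clauses :: "nat \<Rightarrow> clause set" where
  "block_clauses k = insert (Bot, 0, 0)
    (\<Union>i\<in>{..k}. (\<lambda>j. (Leq i j, i, j)) ` ({..k} - {i}))"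

definition min_clauses :: "nat \<Rightarrow> clause set" where
  "min_clauses m = insert (Bot, 0, 0)
    ((\<Union>j\<in>{..m}. (\<lambda>i. (Eql i j, 0, 0)) ` {..<j}) \<union> (\<lambda>i. (Less (Suc m) i, Suc m, i)) ` {..m})"

definition max_clauses :: "nat \<Rightarrow> clause set" where
  "max_clauses m = insert (Bot, 0, 0)
    ((\<Union>j\<in>{..m}. (\<lambda>i. (Eql i j, 0, 0)) ` {..<j}) \<union> (\<lambda>i. (Less i (Suc m), i, Suc m)) ` {..m})"

text \<open>A bound is violated by a tuple with one entry more, whence the successors.\<close>

definition bound_clauses :: "nat \<Rightarrow> nat \<Rightarrow> nat \<Rightarrow> (nat \<times> clause set) set" where
  "bound_clauses k m m' = {(3, {linear_order_clause}), (Suc k, block_clauses k),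
    (Suc m, min_clauses m), (Suc m', max_clauses m')}"

lemma witness_clauses_over:
  assumes "0 < K" "\<forall>i<k. \<forall>j\<le>n i. var i j < K"
  shows "finite (witness_clauses K k n lo hi)" "witness_clauses K k n lo hi \<noteq> {}"
    "\<forall>c\<in>witness_clauses K k n lo hi. clause_over K c"
proof -
  have v: "var i j \<le> K" if "i < k" "j \<le> n i" for i j
    using assms(2) that by (simp add: less_imp_le)
  show "\<forall>c\<in>witness_clauses K k n lo hi. clause_over K c"
    unfolding witness_clauses_def by (auto simp: v)
qed (simp_all add: witness_clauses_def)

lemma bound_clauses_over:
  "finite (bound_clauses k m m')" "bound_clauses k m m' \<noteq> {}"
  "\<forall>(M, D)\<in>bound_clauses k m m'. finite D \<and> D \<noteq> {} \<and> (\<forall>c\<in>D. clause_over M c)"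
  unfolding bound_clauses_def block_clauses_def min_clauses_def max_clauses_def linear_order_clause_def
  by auto

context linear_order_set
begin

lemma clause_holds_guard: "clause_holds A r K (g, i, i) e \<longleftrightarrow> (\<forall>a\<in>A. \<not> sat A r g (e(K := a)))"
  by (simp add: clause_holds_def)

lemma clause_holds_infinite:
  "clause_holds A r K (g, i, j) e \<longleftrightarrow> (\<forall>a\<in>A. sat A r g (e(K := a)) \<longrightarrow>
    infinite (between A r ((e(K := a)) i) ((e(K := a)) j)))"
  by (simp add: clause_holds_def)

lemma witness_clauses_hold:
  assumes "\<forall>i<k. \<forall>j\<le>n i. var i j < K" "\<forall>i<K. e i \<in> A" "A \<noteq> {}"
  shows "(\<forall>c\<in>witness_clauses K k n lo hi. clause_holds A r K c e) \<longleftrightarrow>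
    shape_witness A r k n lo hi (\<lambda>i j. e (var i j))"
proof -
  \<comment> \<open>The variable \<open>K\<close> is bound inside every clause; it must not coincide
    with a variable that holds a witness.\<close>
  have v: "var i j \<noteq> K" if "i < k" "j \<le> n i" for i j
    using assms(1) that by (metis less_irrefl)
  have 1: "clause_holds A r K (Neg (Less (var i j) (var i (Suc j))), 0, 0) e \<longleftrightarrow> e (var i j) \<sqsubset> e (var i (Suc j))"
    "clause_holds A r K (And (Less (var i j) K) (Less K (var i (Suc j))), 0, 0) e \<longleftrightarrow>
      between A r (e (var i j)) (e (var i (Suc j))) = {}" if "i < k" "j < n i" for i j
    using v[of i j] v[of i "Suc j"] that assms(3) by (auto simp: clause_holds_guard between_def)
  have 2: "clause_holds A r K (Neg Bot, var i 0, var (Suc i) 0) e \<longleftrightarrow>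
      infinite (between A r (e (var i 0)) (e (var (Suc i) 0)))" if "Suc i < k" for i
    using v[of i 0] v[of "Suc i" 0] that assms(3) by (auto simp: clause_holds_infinite)
  have 3: "clause_holds A r K (Less K (var i 0), K, var i 0) e \<longleftrightarrow> block_min A r (e (var i 0))"
    "clause_holds A r K (Less (var i (n i)) K, var i (n i), K) e \<longleftrightarrow> block_max A r (e (var i (n i)))"
    if "i < k" for i
    using v[of i 0] v[of i "n i"] that by (auto simp: clause_holds_infinite block_min_def block_max_def)
  have 4: "clause_holds A r K (Bot, 0, 0) e" by (simp add: clause_holds_guard)
  have 5: "\<forall>i<k. \<forall>j\<le>n i. e (var i j) \<in> A" using assms(1,2) by blast
  show ?thesis
    unfolding witness_clauses_def shape_witness_def ball_simps ball_Un
    using 5 by (simp add: 1 2 3 4 imp_conjL all_conj_distrib) (simp add: Ball_def less_diff_conv, blast)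
qed

lemma bound_clauses_hold:
  assumes "A \<noteq> {}"
  shows "(\<forall>(M, D)\<in>bound_clauses k m m'. \<forall>e. (\<forall>i<M. e i \<in> A) \<longrightarrow> (\<exists>c\<in>D. \<not> clause_holds A r M c e)) \<longleftrightarrow>
    at_most_blocks A r k \<and> at_most_points A (block_min A r) m \<and> at_most_points A (block_max A r) m'"
proof -
  obtain x where x: "x \<in> A" using assms by blast
  have lo: "\<not> clause_holds A r 3 linear_order_clause e" if "\<forall>i<3. e i \<in> A" for e
  proof -
    have "e 0 \<in> A" "e 1 \<in> A" "e 2 \<in> A" using that by simp_all
    then show ?thesis
      using x lt_total[of "e 0" "e 1"] lt_asym[of "e 0" "e 1"] lt_trans[of "e 0" "e 1" "e 2"]
      by (auto simp: linear_order_clause_def clause_holds_guard rel_iff)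
  qed
  have bot: "clause_holds A r M (Bot, 0, 0) e" for M e by (simp add: clause_holds_guard)
  have eq: "\<not> clause_holds A r M (Eql i j, 0, 0) e \<longleftrightarrow> e i = e j" if "i < M" "j < M" for i j M e
    using that x by (auto simp: clause_holds_guard)
  have min: "clause_holds A r (Suc m) (Less (Suc m) i, Suc m, i) e \<longleftrightarrow> block_min A r (e i)"
    if "i \<le> m" for i m e
    using that by (auto simp: clause_holds_infinite block_min_def)
  have max: "clause_holds A r (Suc m) (Less i (Suc m), i, Suc m) e \<longleftrightarrow> block_max A r (e i)"
    if "i \<le> m" for i m e
    using that by (auto simp: clause_holds_infinite block_max_def)
  have blocks: "\<not> clause_holds A r (Suc k) (Leq i j, i, j) e \<longleftrightarrow>
      (e i, e j) \<in> r \<and> finite (between A r (e i) (e j))" if "i \<le> k" "j \<le> k" for i j k e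
    using that x by (auto simp: clause_holds_infinite)
  have "(\<exists>c\<in>block_clauses k. \<not> clause_holds A r (Suc k) c e) \<longleftrightarrow>
      (\<exists>i\<le>k. \<exists>j\<le>k. i \<noteq> j \<and> (e i, e j) \<in> r \<and> finite (between A r (e i) (e j)))" for e
    using blocks unfolding block_clauses_def by (auto simp: bot)
  moreover have "(\<exists>c\<in>min_clauses m. \<not> clause_holds A r (Suc m) c e) \<longleftrightarrow>
      (\<exists>j\<le>m. \<exists>i<j. e i = e j) \<or> (\<exists>i\<le>m. \<not> block_min A r (e i))" for m e
    unfolding min_clauses_def bex_simps bex_Un bex_UN by (simp add: bot eq min) blast
  moreover have "(\<exists>c\<in>max_clauses m. \<not> clause_holds A r (Suc m) c e) \<longleftrightarrow>
      (\<exists>j\<le>m. \<exists>i<j. e i = e j) \<or> (\<exists>i\<le>m. \<not> block_max A r (e i))" for m e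
    unfolding max_clauses_def bex_simps bex_Un bex_UN by (simp add: bot eq max) blast
  ultimately show ?thesis
    unfolding bound_clauses_def at_most_blocks_def at_most_points_def
    by (simp add: lo less_Suc_eq_le)
qed

lemma models_shape:
  assumes "0 < K" "\<forall>i<k. \<forall>j\<le>n i. var i j < K"
  shows "models A r (clauses_fm K (witness_clauses K k n lo hi) (bound_clauses k m m')) \<longleftrightarrow>
    A \<noteq> {} \<and> (\<exists>a. shape_witness A r k n lo hi a) \<and> at_most_blocks A r k \<and>
    at_most_points A (block_min A r) m \<and> at_most_points A (block_max A r) m'"
proof -
  have over: "\<forall>(M, D)\<in>bound_clauses k m m'. finite D \<and> (\<forall>c\<in>D. clause_over M c)"
    using bound_clauses_over by fast
  show ?thesis
  proof (cases "A = {}")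
    case True
    \<comment> \<open>As \<open>0 < K\<close>, the existential half asks for an element, so the
      empty structure is no model.\<close>
    then show ?thesis
      unfolding models_clauses_fm[OF witness_clauses_over(1,3)[OF assms] bound_clauses_over(1) over]
      using assms(1) by blast
  next
    case False
    then obtain x where x: "x \<in> A" by blast
    have "(\<exists>e. (\<forall>i<K. e i \<in> A) \<and> (\<forall>c\<in>witness_clauses K k n lo hi. clause_holds A r K c e)) \<longleftrightarrow>
        (\<exists>a. shape_witness A r k n lo hi a)"
    proof
      assume "\<exists>a. shape_witness A r k n lo hi a"
      then obtain a where a: "shape_witness A r k n lo hi a" ..
      \<comment> \<open>Numbers below \<open>K\<close> that name no witness are quantified as well
        and receive the default value \<open>x\<close> in \<open>A\<close>.\<close>
      define e where "e v = (case prod_decode v of (i, j) \<Rightarrow> if i < k \<and> j \<le> n i then a i j else x)" for v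
      have e: "e v \<in> A" for v
        using a x by (auto simp: e_def shape_witness_def split: prod.split)
      have "shape_witness A r k n lo hi (\<lambda>i j. e (var i j)) \<longleftrightarrow> shape_witness A r k n lo hi a"
        by (auto simp: shape_witness_def e_def)
      then show "\<exists>e. (\<forall>i<K. e i \<in> A) \<and> (\<forall>c\<in>witness_clauses K k n lo hi. clause_holds A r K c e)"
        using a e witness_clauses_hold[OF assms(2) _ False] by blast
    qed (use witness_clauses_hold[OF assms(2) _ False] in blast)
    then show ?thesis
      using models_clauses_fm[OF witness_clauses_over(1,3)[OF assms] bound_clauses_over(1) over]
        bound_clauses_hold[OF False] False by simp
  qed
qed

end

section \<open>Nearness and the isomorphism type\<close>

text \<open>In a linear order at least one of the two intervals is empty; requiring both to be
  finite makes the relation symmetric without a case distinction.\<close>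

definition near :: "'a set \<Rightarrow> 'a rel \<Rightarrow> 'a \<Rightarrow> 'a \<Rightarrow> bool" where
  "near A r x y \<longleftrightarrow> x \<in> A \<and> y \<in> A \<and> finite (between A r x y) \<and> finite (between A r y x)"

definition segment :: "'a set \<Rightarrow> 'a rel \<Rightarrow> 'a \<Rightarrow> 'a \<Rightarrow> 'a set" where
  "segment A r x y = {z\<in>A. (x, z) \<in> r \<and> less_in r z y}"

text \<open>At most one of the two segments is nonempty. Being half-open, segments add up, so that
  this becomes an integer coordinate along a block.\<close>

definition signed_dist :: "'a set \<Rightarrow> 'a rel \<Rightarrow> 'a \<Rightarrow> 'a \<Rightarrow> int" where
  "signed_dist A r x y = int (card (segment A r x y)) - int (card (segment A r y x))"

lemma near_sym: "near A r x y \<Longrightarrow> near A r y x"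
  by (simp add: near_def)

lemma near_carrier: "near A r x y \<Longrightarrow> x \<in> A" "near A r x y \<Longrightarrow> y \<in> A"
  by (simp_all add: near_def)

lemma at_most_points_iff:
  "at_most_points A P m \<longleftrightarrow> finite {x\<in>A. P x} \<and> card {x\<in>A. P x} \<le> m" (is "?L \<longleftrightarrow> ?R")
proof
  assume ?L
  show ?R
  proof (rule ccontr)
    assume "\<not> ?R"
    then have "infinite {x\<in>A. P x} \<or> Suc m \<le> card {x\<in>A. P x}" by linarith
    then obtain T where T: "T \<subseteq> {x\<in>A. P x}" "finite T" "card T = Suc m"
      using infinite_arbitrarily_large[of "{x\<in>A. P x}" "Suc m"]
        obtain_subset_with_card_n[of "Suc m" "{x\<in>A. P x}"] by blast
    then obtain h where h: "bij_betw h {0..<Suc m} T"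
      using ex_bij_betw_nat_finite[OF T(2)] by auto
    have hP: "h i \<in> A \<and> P (h i)" if "i \<le> m" for i
      using subsetD[OF T(1) bij_betwE[OF h, rule_format, of i]] that by simp
    have "(\<forall>i\<le>m. h i \<in> A) \<longrightarrow> (\<exists>j\<le>m. \<exists>i<j. h i = h j) \<or> (\<exists>i\<le>m. \<not> P (h i))"
      using \<open>?L\<close> unfolding at_most_points_def by (rule spec)
    then have "\<exists>j\<le>m. \<exists>i<j. h i = h j" using hP by blast
    then obtain i j where "j \<le> m" "i < j" "h i = h j" by blast
    then show False using inj_onD[OF bij_betw_imp_inj_on[OF h], of i j] by simp
  qed
next
  assume R: ?R
  show ?L
    unfolding at_most_points_def
  proof (intro allI impI disjCI)
    fix y assume y: "\<forall>i\<le>m. y i \<in> A" "\<not> (\<exists>i\<le>m. \<not> P (y i))"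
    then have "y ` {..m} \<subseteq> {x\<in>A. P x}" by auto
    then have "card (y ` {..m}) \<le> card {x\<in>A. P x}" using R by (intro card_mono) simp_all
    then have "\<not> inj_on y {..m}" using R by (auto dest: card_image)
    then obtain i j where "i \<le> m" "j \<le> m" "i \<noteq> j" "y i = y j" by (auto simp: inj_on_def)
    then show "\<exists>j\<le>m. \<exists>i<j. y i = y j"
      by (cases "i < j") (fastforce, metis linorder_neqE_nat)
  qed
qed

section \<open>Blocks as convex classes\<close>

context linear_order_set
begin

abbreviation btw where "btw \<equiv> between A r"

lemma between_subset: "y \<in> A \<Longrightarrow> btw x z \<subseteq> insert y (btw x y \<union> btw y z)"
  using lt_total by (auto simp: between_def)

lemma near_refl: "x \<in> A \<Longrightarrow> near A r x x"
  by (simp add: near_def)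

lemma near_trans: "near A r x y \<Longrightarrow> near A r y z \<Longrightarrow> near A r x z"
  using between_subset[of y x z] between_subset[of y z x] by (auto simp: near_def intro: finite_subset)

lemma between_empty: "x \<sqsubset> y \<Longrightarrow> btw y x = {}"
  using lt_trans lt_irrefl unfolding between_def by blast

lemma near_iff_finite: "x \<sqsubset> y \<Longrightarrow> near A r x y \<longleftrightarrow> finite (btw x y)"
  using between_empty lt_carrier by (auto simp: near_def)

lemma near_convex:
  assumes "x \<sqsubset> y" "y \<sqsubset> z" "near A r x z"
  shows "near A r x y" "near A r y z"
proof -
  have "btw x y \<subseteq> btw x z" "btw y z \<subseteq> btw x z"
    using assms lt_trans by (auto simp: between_def)
  then show "near A r x y" "near A r y z"
    using assms finite_subset lt_trans[OF assms(1,2)] by (auto simp: near_iff_finite)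
qed

text \<open>By convexity an element of one block cannot be overtaken by an element of another, so
  distinct blocks are ordered as wholes.\<close>

lemma far_less:
  assumes "x \<sqsubset> y" "\<not> near A r x y" "near A r x x'" "near A r y y'"
  shows "x' \<sqsubset> y'"
proof -
  have "x' \<sqsubset> y"
    using lt_total[of x' y] near_convex(1)[of x y x'] assms near_carrier by metis
  moreover have "\<not> near A r x' y" using assms(2,3) near_trans by blast
  ultimately show ?thesis
    using lt_total[of x' y'] near_convex(2)[of y' x' y] near_sym[OF assms(4)] near_carrier assms(3) by metis
qed

lemma finite_least:
  assumes "finite T" "T \<subseteq> A" "T \<noteq> {}"
  shows "\<exists>x\<in>T. \<forall>y\<in>T. x = y \<or> x \<sqsubset> y" "\<exists>x\<in>T. \<forall>y\<in>T. x = y \<or> y \<sqsubset> x"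
proof -
  obtain f where f: "bij_betw f {..<card T} T" "\<forall>i j. i < j \<longrightarrow> j < card T \<longrightarrow> f i \<sqsubset> f j"
    using increasing_enumeration[OF assms(1,2)] by blast
  have T: "T = f ` {..<card T}" using f(1) by (simp add: bij_betw_def)
  have pos: "0 < card T" using assms by (simp add: card_gt_0_iff)
  have "f 0 \<in> T" "f (card T - 1) \<in> T" using T pos by auto
  moreover have "f 0 = f i \<or> f 0 \<sqsubset> f i" if "i < card T" for i using f(2) that by (cases i) auto
  moreover have "f (card T - 1) = f i \<or> f i \<sqsubset> f (card T - 1)" if "i < card T" for i
    using f(2) that by (cases "i = card T - 1") auto
  ultimately show "\<exists>x\<in>T. \<forall>y\<in>T. x = y \<or> x \<sqsubset> y" "\<exists>x\<in>T. \<forall>y\<in>T. x = y \<or> y \<sqsubset> x"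
    by (metis T imageE lessThan_iff)+
qed

lemma successor:
  assumes "x \<sqsubset> y" "finite (btw x y)"
  shows "\<exists>z. x \<sqsubset> z \<and> btw x z = {} \<and> (z = y \<or> z \<sqsubset> y)"
proof -
  let ?T = "insert y (btw x y)"
  obtain z where z: "z \<in> ?T" "\<forall>w\<in>?T. z = w \<or> z \<sqsubset> w"
    using finite_least(1)[of ?T] assms lt_carrier by (auto simp: between_def)
  have "x \<sqsubset> z" "z = y \<or> z \<sqsubset> y" using z(1) assms(1) by (auto simp: between_def)
  moreover have "w \<in> ?T" if "w \<in> btw x z" for w
    using that \<open>z = y \<or> z \<sqsubset> y\<close> lt_trans by (auto simp: between_def)
  then have "btw x z = {}" using z(2) lt_asym by (fastforce simp: between_def)
  ultimately show ?thesis by blast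
qed

lemma predecessor:
  assumes "y \<sqsubset> x" "finite (btw y x)"
  shows "\<exists>z. z \<sqsubset> x \<and> btw z x = {}"
proof -
  let ?T = "insert y (btw y x)"
  obtain z where z: "z \<in> ?T" "\<forall>w\<in>?T. z = w \<or> w \<sqsubset> z"
    using finite_least(2)[of ?T] assms lt_carrier by (auto simp: between_def)
  have "z \<sqsubset> x" "z = y \<or> y \<sqsubset> z" using z(1) assms(1) by (auto simp: between_def)
  moreover have "w \<in> ?T" if "w \<in> btw z x" for w
    using that \<open>z = y \<or> y \<sqsubset> z\<close> lt_trans by (auto simp: between_def)
  then have "btw z x = {}" using z(2) lt_asym by (fastforce simp: between_def)
  ultimately show ?thesis by blast
qed

section \<open>Distances within a block\<close>

lemma segment_empty: "y = x \<or> y \<sqsubset> x \<Longrightarrow> segment A r x y = {}"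
  unfolding segment_def rel_iff using lt_trans lt_irrefl by blast

lemma segment_less: "x \<sqsubset> y \<Longrightarrow> segment A r x y = insert x (btw x y)"
  using lt_carrier by (auto simp: segment_def between_def rel_iff)

lemma finite_segment: "near A r x y \<Longrightarrow> finite (segment A r x y)"
  using lt_total[of x y] segment_empty segment_less by (auto simp: near_def)

text \<open>Inside a finite set that contains both segments, the distance is a difference of two
  positions. With one set serving three points, additivity is a telescoping sum, whatever the order
  of the points.\<close>

lemma signed_dist_count:
  assumes "x \<in> A" "y \<in> A" "finite S" "segment A r x y \<subseteq> S" "segment A r y x \<subseteq> S"
  shows "signed_dist A r x y = int (card {z\<in>S. z \<sqsubset> y}) - int (card {z\<in>S. z \<sqsubset> x})"
proof -
  have *: "card {z\<in>S. z \<sqsubset> y} = card {z\<in>S. z \<sqsubset> x} + card (segment A r x y)"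
    if "x = y \<or> x \<sqsubset> y" "segment A r x y \<subseteq> S" "x \<in> A" for x y
  proof -
    have "z \<sqsubset> y" if "z \<sqsubset> x" for z
      using that \<open>x = y \<or> x \<sqsubset> y\<close> lt_trans by blast
    then have "{z\<in>S. z \<sqsubset> y} = {z\<in>S. z \<sqsubset> x} \<union> segment A r x y"
      using that(2) lt_carrier(1) lt_total[OF \<open>x \<in> A\<close>] \<open>x \<in> A\<close> unfolding segment_def rel_iff by blast
    moreover have "{z\<in>S. z \<sqsubset> x} \<inter> segment A r x y = {}"
      unfolding segment_def rel_iff using lt_asym lt_irrefl by blast
    ultimately show ?thesis
      using \<open>finite S\<close> that(2) by (simp add: card_Un_disjoint finite_subset)
  qed
  show ?thesis
  proof (cases "x = y \<or> x \<sqsubset> y")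
    case True
    then show ?thesis using *[of x y] assms segment_empty[of x y] by (auto simp: signed_dist_def)
  next
    case False
    then have "y \<sqsubset> x" using lt_total assms by blast
    then show ?thesis using *[of y x] assms segment_empty[of y x] by (auto simp: signed_dist_def)
  qed
qed

lemma signed_dist_add:
  assumes "near A r x y" "near A r y z"
  shows "signed_dist A r x z = signed_dist A r x y + signed_dist A r y z"
proof -
  define S where "S = (\<Union>u\<in>{x, y, z}. \<Union>v\<in>{x, y, z}. segment A r u v)"
  have near: "near A r u v" if "u \<in> {x, y, z}" "v \<in> {x, y, z}" for u v
    using that assms near_trans[OF assms] assms[THEN near_sym] near_trans[OF assms, THEN near_sym]
      near_carrier[OF assms(1)] near_carrier[OF assms(2)] near_refl by auto
  then have fin: "finite S" unfolding S_def using finite_segment by blast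
  have S: "segment A r u v \<subseteq> S" if "u \<in> {x, y, z}" "v \<in> {x, y, z}" for u v
    unfolding S_def by (rule SUP_upper2[OF that(1) SUP_upper2[OF that(2) order_refl]])
  have "signed_dist A r u v = int (card {w\<in>S. w \<sqsubset> v}) - int (card {w\<in>S. w \<sqsubset> u})"
    if "u \<in> {x, y, z}" "v \<in> {x, y, z}" for u v
    by (rule signed_dist_count[OF near_carrier[OF near[OF that]] fin S[OF that] S[OF that(2,1)]])
  from this[of x z] this[of x y] this[of y z] show ?thesis by simp
qed

lemma signed_dist_self [simp]: "signed_dist A r x x = 0"
  by (simp add: signed_dist_def)

lemma signed_dist_mono:
  assumes "near A r x y" "y \<sqsubset> z" "near A r x z"
  shows "signed_dist A r x y < signed_dist A r x z"
proof -
  have n: "near A r y z" using near_trans[OF near_sym[OF assms(1)] assms(3)] .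
  then have "card (segment A r y z) > 0"
    using finite_segment[OF n] segment_less[OF assms(2)] by (auto simp: card_gt_0_iff)
  then have "signed_dist A r y z > 0" by (simp add: signed_dist_def segment_empty assms(2))
  then show ?thesis using signed_dist_add[OF assms(1) n] by simp
qed

lemma signed_dist_adjacent:
  assumes "y \<sqsubset> z" "btw y z = {}"
  shows "near A r y z" "near A r x y \<Longrightarrow> signed_dist A r x z = signed_dist A r x y + 1"
proof -
  show n: "near A r y z" using assms near_iff_finite by simp
  have "signed_dist A r y z = 1"
    by (simp add: signed_dist_def segment_empty segment_less assms)
  then show "near A r x y \<Longrightarrow> signed_dist A r x z = signed_dist A r x y + 1"
    using signed_dist_add n by simp
qed

lemma not_block_max:
  assumes "x \<in> A" "\<not> block_max A r x"
  shows "\<exists>z. x \<sqsubset> z \<and> btw x z = {}"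
proof -
  obtain y where "x \<sqsubset> y" "finite (btw x y)" using assms(2) by (auto simp: block_max_def)
  from successor[OF this] show ?thesis by blast
qed

lemma not_block_min:
  assumes "x \<in> A" "\<not> block_min A r x"
  shows "\<exists>z. z \<sqsubset> x \<and> btw z x = {}"
proof -
  obtain y where "y \<sqsubset> x" "finite (btw y x)" using assms(2) by (auto simp: block_min_def)
  from predecessor[OF this] show ?thesis .
qed

lemma block_min_near: "block_min A r x \<Longrightarrow> near A r x y \<Longrightarrow> x = y \<or> x \<sqsubset> y"
  using lt_total by (auto simp: block_min_def near_def)

lemma block_max_near: "block_max A r x \<Longrightarrow> near A r x y \<Longrightarrow> x = y \<or> y \<sqsubset> x"
  using lt_total by (auto simp: block_max_def near_def)

end

section \<open>The shape determines the isomorphism type\<close>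

definition shape_carrier :: "nat \<Rightarrow> (nat \<Rightarrow> nat) \<Rightarrow> (nat \<Rightarrow> bool) \<Rightarrow> (nat \<Rightarrow> bool) \<Rightarrow> (nat \<times> int) set" where
  "shape_carrier k n lo hi = {(i, z). i < k \<and> (lo i \<longrightarrow> 0 \<le> z) \<and> (hi i \<longrightarrow> z \<le> int (n i))}"

definition lex_order :: "(nat \<times> int) rel" where
  "lex_order = {((i, z), (j, w)). i < j \<or> i = j \<and> z \<le> w}"

definition has_shape :: "'a set \<Rightarrow> 'a rel \<Rightarrow> nat \<Rightarrow> (nat \<Rightarrow> nat) \<Rightarrow> (nat \<Rightarrow> bool) \<Rightarrow> (nat \<Rightarrow> bool) \<Rightarrow> bool" where
  "has_shape A r k n lo hi \<longleftrightarrow> (\<exists>a. shape_witness A r k n lo hi a) \<and> at_most_blocks A r k \<and>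
    at_most_points A (block_min A r) (card {i. i < k \<and> lo i}) \<and>
    at_most_points A (block_max A r) (card {i. i < k \<and> hi i})"

context linear_order_set
begin

text \<open>The coordinates of an element are the index of its block and its signed distance from
  \<open>a i 0\<close>. Far witnesses make the index unique, and the bounds on blocks and block ends
  make the image exactly the standard carrier.\<close>

lemma isomorphic_shape:
  assumes "has_shape A r k n lo hi"
  shows "isomorphic A r (shape_carrier k n lo hi) lex_order"
proof -
  obtain a where "shape_witness A r k n lo hi a"
    using assms by (auto simp: has_shape_def)
  then have w: "(\<forall>i<k. \<forall>j\<le>n i. a i j \<in> A)"
    "(\<forall>i<k. \<forall>j<n i. a i j \<sqsubset> a i (Suc j) \<and> btw (a i j) (a i (Suc j)) = {})"
    "(\<forall>i. Suc i < k \<longrightarrow> infinite (btw (a i 0) (a (Suc i) 0)))"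
    "(\<forall>i<k. lo i \<longrightarrow> block_min A r (a i 0))"
    "(\<forall>i<k. hi i \<longrightarrow> block_max A r (a i (n i)))"
    unfolding shape_witness_def by simp_all
  have a: "\<And>i j. i < k \<Longrightarrow> j \<le> n i \<Longrightarrow> a i j \<in> A"
    and adj: "\<And>i j. i < k \<Longrightarrow> j < n i \<Longrightarrow> a i j \<sqsubset> a i (Suc j) \<and> btw (a i j) (a i (Suc j)) = {}"
    and inf: "\<And>i. Suc i < k \<Longrightarrow> infinite (btw (a i 0) (a (Suc i) 0))"
    and lo: "\<And>i. i < k \<Longrightarrow> lo i \<Longrightarrow> block_min A r (a i 0)"
    and hi: "\<And>i. i < k \<Longrightarrow> hi i \<Longrightarrow> block_max A r (a i (n i))"
    using w by simp_all
  define b where "b i = a i 0" for i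
  have b: "b i \<in> A" if "i < k" for i using a that by (simp add: b_def)
  have far: "b i \<sqsubset> b j \<and> \<not> near A r (b i) (b j)" if "i < j" "j < k" for i j
    using that
  proof (induction j)
    case (Suc j)
    have "btw (b j) (b (Suc j)) \<noteq> {}" using inf[OF Suc.prems(2)] by (auto simp: b_def)
    then have lt: "b j \<sqsubset> b (Suc j)" using lt_trans by (auto simp: between_def)
    then have "\<not> near A r (b j) (b (Suc j))"
      using inf[OF Suc.prems(2)] by (simp add: near_def b_def)
    then show ?case
      using lt Suc lt_trans near_convex(2) by (metis Suc_lessD less_SucE)
  qed simp
  have sep: "i = j" if "near A r (b i) x" "near A r (b j) x" "i < k" "j < k" for i j x
    using that far near_trans near_sym by (metis linorder_neqE_nat)
  have chain: "near A r (b i) (a i j) \<and> signed_dist A r (b i) (a i j) = int j" if "i < k" "j \<le> n i" for i j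
    using that(2)
  proof (induction j)
    case 0
    then show ?case using b[OF that(1)] near_refl by (simp add: b_def[symmetric])
  next
    case (Suc j)
    then show ?case
      using adj[OF that(1), of j] signed_dist_adjacent near_trans by fastforce
  qed
  have cover: "\<exists>i<k. near A r (b i) x" if "x \<in> A" for x
  proof (rule ccontr)
    assume contra: "\<not> (\<exists>i<k. near A r (b i) x)"
    \<comment> \<open>An uncovered \<open>x\<close> together with the \<open>k\<close> points
      \<open>b i\<close> would give \<open>k + 1\<close> pairwise distant elements.\<close>
    define y where "y i = (if i < k then b i else x)" for i
    have "\<forall>i\<le>k. y i \<in> A" using b that by (simp add: y_def)
    then obtain i j where ij: "i \<le> k" "j \<le> k" "i \<noteq> j" "(y i, y j) \<in> r" "finite (btw (y i) (y j))"
      using assms unfolding has_shape_def at_most_blocks_def by blast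
    then have "near A r (y i) (y j)" using near_iff_finite near_refl by (auto simp: rel_iff)
    moreover have "\<not> near A r (b i) x" if "i < k" for i using contra that by blast
    moreover have "\<not> near A r (b i) (b j)" if "i < k" "j < k" "i \<noteq> j" for i j
      using sep[of i "b j" j] near_refl[OF b] that by blast
    ultimately show False
      using ij(1-3) near_sym[of A r x "b j"] by (cases "i < k"; cases "j < k") (auto simp: y_def)
  qed
  \<comment> \<open>The witnesses with \<open>lo i\<close> are distinct first elements of blocks and
    as many as the bound allows, so there are no others. The same count is used for last elements
    below.\<close>
  have min: "\<exists>i<k. lo i \<and> x = b i" if "x \<in> A" "block_min A r x" for x
  proof -
    have "inj_on b {i. i < k \<and> lo i}"
    proof (rule inj_onI)
      fix i j assume "i \<in> {i. i < k \<and> lo i}" "j \<in> {i. i < k \<and> lo i}" "b i = b j"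
      then show "i = j" using sep[of i "b j" j] near_refl[OF b] by simp
    qed
    then have "card (b ` {i. i < k \<and> lo i}) = card {i. i < k \<and> lo i}" by (rule card_image)
    moreover have "b ` {i. i < k \<and> lo i} \<subseteq> {x\<in>A. block_min A r x}"
      using lo b by (auto simp: b_def)
    ultimately have "b ` {i. i < k \<and> lo i} = {x\<in>A. block_min A r x}"
      using assms unfolding has_shape_def at_most_points_iff
      by (intro card_seteq) simp_all
    then show ?thesis using that by blast
  qed
  have max: "\<exists>i<k. hi i \<and> x = a i (n i)" if "x \<in> A" "block_max A r x" for x
  proof -
    let ?c = "\<lambda>i. a i (n i)"
    have "inj_on ?c {i. i < k \<and> hi i}"
    proof (rule inj_onI)
      fix i j assume "i \<in> {i. i < k \<and> hi i}" "j \<in> {i. i < k \<and> hi i}" "?c i = ?c j"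
      then show "i = j" using sep[of i "?c j" j] chain[of i "n i"] chain[of j "n j"] by simp
    qed
    then have "card (?c ` {i. i < k \<and> hi i}) = card {i. i < k \<and> hi i}" by (rule card_image)
    moreover have "?c ` {i. i < k \<and> hi i} \<subseteq> {x\<in>A. block_max A r x}"
      using hi a by auto
    ultimately have "?c ` {i. i < k \<and> hi i} = {x\<in>A. block_max A r x}"
      using assms unfolding has_shape_def at_most_points_iff
      by (intro card_seteq) simp_all
    then show ?thesis using that by blast
  qed
  define ind where "ind x = (SOME i. i < k \<and> near A r (b i) x)" for x
  have ind: "ind x < k" "near A r (b (ind x)) x" if "x \<in> A" for x
    using someI_ex[of "\<lambda>i. i < k \<and> near A r (b i) x"] cover[OF that] by (auto simp: ind_def)
  define f where "f x = (ind x, signed_dist A r (b (ind x)) x)" for x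
  have mono: "ind x < ind y \<or> ind x = ind y \<and> signed_dist A r (b (ind x)) x < signed_dist A r (b (ind y)) y"
    if "x \<sqsubset> y" for x y
  proof -
    have xy: "x \<in> A" "y \<in> A" using lt_carrier that by blast+
    consider "ind x < ind y" | "ind x = ind y" | "ind y < ind x" by linarith
    then show ?thesis
    proof cases
      case 2
      then show ?thesis using signed_dist_mono that ind xy by metis
    next
      case 3
      then have "y \<sqsubset> x" using far_less far ind xy by metis
      then show ?thesis using that lt_asym by blast
    qed simp
  qed
  have "inj_on f A"
  proof (rule inj_onI)
    fix x y assume "x \<in> A" "y \<in> A" "f x = f y"
    then show "x = y" using mono[of x y] mono[of y x] lt_total[of x y] by (auto simp: f_def)
  qed
  moreover have "f ` A = shape_carrier k n lo hi"
  proof (intro equalityI subsetI)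
    fix u assume "u \<in> f ` A"
    then obtain x where x: "x \<in> A" and u: "u = f x" by blast
    let ?i = "ind x"
    have i: "?i < k" and nr: "near A r (b ?i) x" using ind x by auto
    have "0 \<le> signed_dist A r (b ?i) x" if "lo ?i"
      using block_min_near[OF lo[OF i that, folded b_def] nr]
        signed_dist_mono[OF near_refl[OF b[OF i]] _ nr] by auto
    moreover have "signed_dist A r (b ?i) x \<le> int (n ?i)" if "hi ?i"
    proof -
      have c: "near A r (b ?i) (a ?i (n ?i))" "signed_dist A r (b ?i) (a ?i (n ?i)) = int (n ?i)"
        using chain[OF i le_refl] by blast+
      then have "x = a ?i (n ?i) \<or> x \<sqsubset> a ?i (n ?i)"
        using block_max_near[OF hi[OF i that] near_trans[OF near_sym nr]] by metis
      then show ?thesis using signed_dist_mono[OF nr _ c(1)] c(2) by auto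
    qed
    ultimately show "u \<in> shape_carrier k n lo hi"
      using i by (simp add: u f_def shape_carrier_def)
  next
    fix u assume "u \<in> shape_carrier k n lo hi"
    then obtain i z where u: "u = (i, z)" "i < k" "lo i \<longrightarrow> 0 \<le> z" "hi i \<longrightarrow> z \<le> int (n i)"
      by (auto simp: shape_carrier_def)
    \<comment> \<open>Walk upwards by immediate successors. The walk can stop only at the last
      element of the block, which is \<open>a i (n i)\<close> at distance
      \<open>n i\<close>.\<close>
    have up: "\<exists>x. near A r (b i) x \<and> signed_dist A r (b i) x = int m" if "hi i \<longrightarrow> m \<le> n i" for m
      using that
    proof (induction m)
      case 0
      show ?case using near_refl[OF b[OF u(2)]] by (intro exI[of _ "b i"]) simp
    next
      case (Suc m)
      then obtain x where x: "near A r (b i) x" "signed_dist A r (b i) x = int m" by auto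
      have "\<not> block_max A r x"
      proof
        assume "block_max A r x"
        then obtain j where j: "j < k" "hi j" "x = a j (n j)"
          using max[OF near_carrier(2)[OF x(1)]] by blast
        then have "j = i" using sep[OF _ x(1) j(1) u(2)] chain[OF j(1) le_refl] by simp
        then show False using chain[OF u(2) le_refl] x(2) Suc.prems j by simp
      qed
      then obtain y where "x \<sqsubset> y" "btw x y = {}"
        using not_block_max[OF near_carrier(2)[OF x(1)]] by blast
      then show ?case
        using signed_dist_adjacent(1)[of x y] signed_dist_adjacent(2)[of x y "b i"] x near_trans[of "b i" x y]
        by (intro exI[of _ y]) simp
    qed
    \<comment> \<open>Downwards the walk could stop only at a first element; those are the points
      \<open>b j\<close> with \<open>lo j\<close>, and none of them lies in this block.\<close>
    have down: "\<exists>x. near A r (b i) x \<and> signed_dist A r (b i) x = - int m" if "\<not> lo i" for m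
    proof (induction m)
      case 0
      show ?case using near_refl[OF b[OF u(2)]] by (intro exI[of _ "b i"]) simp
    next
      case (Suc m)
      then obtain x where x: "near A r (b i) x" "signed_dist A r (b i) x = - int m" by auto
      have "\<not> block_min A r x"
      proof
        assume "block_min A r x"
        then obtain j where j: "j < k" "lo j" "x = b j"
          using min[OF near_carrier(2)[OF x(1)]] by blast
        then have "j = i" using sep[OF _ x(1) j(1) u(2)] near_refl[OF b] by simp
        then show False using that j by simp
      qed
      then obtain y where y: "y \<sqsubset> x" "btw y x = {}"
        using not_block_min[OF near_carrier(2)[OF x(1)]] by blast
      then have "near A r (b i) y"
        using near_trans[OF x(1) near_sym[OF signed_dist_adjacent(1)]] by blast
      then show ?case
        using signed_dist_adjacent(2)[OF y, of "b i"] x by (intro exI[of _ y]) simp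
    qed
    have "\<exists>x. near A r (b i) x \<and> signed_dist A r (b i) x = z"
    proof (cases "0 \<le> z")
      case True
      then show ?thesis using up[of "nat z"] u(4) by (simp add: nat_le_iff)
    next
      case False
      then show ?thesis using down[of "nat (- z)"] u(3) by auto
    qed
    then obtain x where x: "near A r (b i) x" "signed_dist A r (b i) x = z" by blast
    then have "x \<in> A" by (simp add: near_def)
    then have "ind x = i" using sep[OF ind(2) x(1) ind(1) u(2)] by blast
    then show "u \<in> f ` A" using x u(1) \<open>x \<in> A\<close> by (auto simp: f_def)
  qed
  ultimately have "bij_betw f A (shape_carrier k n lo hi)" by (simp add: bij_betw_def)
  moreover have "(x, y) \<in> r \<longleftrightarrow> (f x, f y) \<in> lex_order" if "x \<in> A" "y \<in> A" for x y
  proof -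
    consider "x \<sqsubset> y" | "x = y" | "y \<sqsubset> x" using lt_total \<open>x \<in> A\<close> \<open>y \<in> A\<close> by blast
    then show ?thesis
    proof cases
      case 1
      then show ?thesis using mono[OF 1] by (auto simp: f_def lex_order_def rel_iff)
    next
      case 2
      then show ?thesis using that by (simp add: f_def lex_order_def rel_iff)
    next
      case 3
      then have "\<not> x \<sqsubset> y" "x \<noteq> y" using lt_asym lt_irrefl by blast+
      then show ?thesis using mono[OF 3] by (auto simp: f_def lex_order_def rel_iff)
    qed
  qed
  ultimately show ?thesis unfolding isomorphic_def by (intro exI[of _ f]) simp
qed

end

section \<open>Orders of Hausdorff rank 1\<close>

text \<open>There are at most \<open>N\<close> blocks, phrased by finite sets of representatives:
  such a set can be cut into its traces on the summands of an ordered sum.\<close>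

definition few_blocks :: "'a set \<Rightarrow> 'a rel \<Rightarrow> nat \<Rightarrow> bool" where
  "few_blocks A r N \<longleftrightarrow>
    (\<forall>S\<subseteq>A. finite S \<longrightarrow> pairwise (\<lambda>x y. \<not> near A r x y) S \<longrightarrow> card S \<le> N)"

context linear_order_set
begin

text \<open>Replacing \<open>p\<close> by its immediate successor shortens the segment, so induction
  on the size of the segment applies.\<close>

lemma consecutive_chain:
  assumes "near A r p q" "p = q \<or> p \<sqsubset> q"
  shows "\<exists>n c. c 0 = p \<and> c n = q \<and> (\<forall>j\<le>n. c j \<in> A) \<and>
    (\<forall>j<n. c j \<sqsubset> c (Suc j) \<and> btw (c j) (c (Suc j)) = {})"
  using assms
proof (induction "card (segment A r p q)" arbitrary: p rule: less_induct)
  case less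
  show ?case
  proof (cases "p = q")
    case True
    then show ?thesis
      using less.prems(1) by (intro exI[of _ "0::nat"] exI[of _ "\<lambda>_. p"]) (simp add: near_def)
  next
    case False
    then have "p \<sqsubset> q" "finite (btw p q)" using less.prems by (simp_all add: near_def)
    then obtain p' where p': "p \<sqsubset> p'" "btw p p' = {}" "p' = q \<or> p' \<sqsubset> q"
      using successor by blast
    have "p' \<in> A" using lt_carrier(2)[OF p'(1)] .
    then have near: "near A r p' q"
      using p'(1,3) near_convex(2)[of p p' q] less.prems(1) near_refl by blast
    have "segment A r p' q \<subseteq> segment A r p q"
      unfolding segment_def rel_iff using p'(1) lt_trans by blast
    moreover have "p \<in> segment A r p q" "p \<notin> segment A r p' q"
      using \<open>p \<sqsubset> q\<close> p'(1) lt_asym[of p p'] lt_carrier(1) by (auto simp: segment_def rel_iff)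
    ultimately have "card (segment A r p' q) < card (segment A r p q)"
      using finite_segment[OF less.prems(1)] by (intro psubset_card_mono) auto
    from less.hyps[OF this near p'(3)] obtain n c where c: "c 0 = p'" "c n = q" "\<forall>j\<le>n. c j \<in> A"
      "\<forall>j<n. c j \<sqsubset> c (Suc j) \<and> btw (c j) (c (Suc j)) = {}"
      by blast
    define d where "d = case_nat p c"
    have "d 0 = p" "d (Suc n) = q" by (simp_all add: d_def c(2))
    moreover have "d j \<in> A" if "j \<le> Suc n" for j
      using that c(3) lt_carrier(1)[OF p'(1)] by (cases j) (simp_all add: d_def)
    moreover have "d j \<sqsubset> d (Suc j) \<and> btw (d j) (d (Suc j)) = {}" if "j < Suc n" for j
      using that c(1,4) p'(1,2) by (cases j) (simp_all add: d_def)
    ultimately show ?thesis by (intro exI[of _ "Suc n"] exI[of _ d]) simp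
  qed
qed

text \<open>The bound on the number of blocks gives a finite system of representatives; the
  remaining data are read off block by block.\<close>

lemma has_shape_exists:
  assumes "few_blocks A r N"
  shows "\<exists>k n lo hi. has_shape A r k n lo hi"
proof -
  let ?P = "\<lambda>S. S \<subseteq> A \<and> finite S \<and> pairwise (\<lambda>x y. \<not> near A r x y) S"
  have "?P {}" by simp
  moreover have "\<forall>S. ?P S \<longrightarrow> card S < Suc N"
    using assms by (auto simp: few_blocks_def less_Suc_eq_le)
  \<comment> \<open>A set of pairwise distant elements of largest size meets every block, since
    otherwise it could be enlarged; it meets each block only once.\<close>
  ultimately obtain S where S: "?P S" and maximal: "\<And>T. ?P T \<Longrightarrow> card T \<le> card S"
    using ex_has_greatest_nat[of ?P "{}" card "Suc N"] by blast
  define k where "k = card S"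
  obtain g where g: "bij_betw g {..<k} S" "\<And>i j. i < j \<Longrightarrow> j < k \<Longrightarrow> g i \<sqsubset> g j"
    using increasing_enumeration[of S] S by (auto simp: k_def)
  have gS: "g i \<in> S" if "i < k" for i using bij_betwE[OF g(1)] that by blast
  then have gA: "g i \<in> A" if "i < k" for i using S that by blast
  have far: "\<not> near A r (g i) (g j)" if "i < j" "j < k" for i j
  proof -
    have "pairwise (\<lambda>x y. \<not> near A r x y) S" using S by blast
    moreover have "g i \<in> S" "g j \<in> S" using gS that by simp_all
    moreover have "g i \<noteq> g j" using g(2)[OF that] by auto
    ultimately show ?thesis by (rule pairwiseD)
  qed
  have cover: "\<exists>i<k. near A r (g i) x" if "x \<in> A" for x
  proof (rule ccontr)
    assume contra: "\<not> (\<exists>i<k. near A r (g i) x)"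
    have *: "\<not> near A r y x" "\<not> near A r x y" if y: "y \<in> S" for y
    proof -
      obtain i where "i < k" "y = g i"
        using y bij_betw_imp_surj_on[OF g(1)] by blast
      then show "\<not> near A r y x" using contra by blast
      then show "\<not> near A r x y" using near_sym[of A r x y] by blast
    qed
    then have "x \<notin> S" using near_refl[OF that] by blast
    moreover have "?P (insert x S)" using S that * by (auto simp: pairwise_insert)
    ultimately show False using maximal[of "insert x S"] S by simp
  qed
  have sep: "i = j" if "near A r (g i) x" "near A r (g j) x" "i < k" "j < k" for i j x
  proof -
    have "near A r (g i) (g j)" using near_trans[OF that(1) near_sym[OF that(2)]] .
    moreover from near_sym[OF this] have "near A r (g j) (g i)" .
    ultimately show ?thesis using far[of i j] far[of j i] that(3,4) by (cases i j rule: linorder_cases) auto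
  qed
  define lo where "lo i \<longleftrightarrow> (\<exists>x. near A r (g i) x \<and> block_min A r x)" for i
  define hi where "hi i \<longleftrightarrow> (\<exists>x. near A r (g i) x \<and> block_max A r x)" for i
  have "\<exists>p q. near A r (g i) p \<and> near A r (g i) q \<and> (p = q \<or> p \<sqsubset> q) \<and>
      (lo i \<longrightarrow> block_min A r p) \<and> (hi i \<longrightarrow> block_max A r q)" if "i < k" for i
  proof -
    have refl: "near A r (g i) (g i)" using near_refl[OF gA[OF that]] .
    \<comment> \<open>If the block has both ends, these are \<open>p\<close> and \<open>q\<close>,
      and nearness puts them in order. If it has at most one end, \<open>p = q\<close> will do: that
      end, or else the representative \<open>g i\<close>.\<close>
    consider x y where "near A r (g i) x" "block_min A r x" "near A r (g i) y" "block_max A r y"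
      | x where "near A r (g i) x" "block_min A r x" "\<not> hi i"
      | y where "near A r (g i) y" "block_max A r y" "\<not> lo i"
      | "\<not> lo i" "\<not> hi i"
      unfolding lo_def hi_def by blast
    then show ?thesis
    proof cases
      case (1 x y)
      then have "x = y \<or> x \<sqsubset> y"
        using block_min_near[OF 1(2) near_trans[OF near_sym[OF 1(1)] 1(3)]] by blast
      then show ?thesis using 1 by blast
    next
      case (2 x)
      then show ?thesis by blast
    next
      case (3 y)
      then show ?thesis by blast
    next
      case 4
      then show ?thesis using refl by blast
    qed
  qed
  then have "\<forall>i\<in>{..<k}. \<exists>u. near A r (g i) (fst u) \<and> near A r (g i) (snd u) \<and>
      (fst u = snd u \<or> fst u \<sqsubset> snd u) \<and> (lo i \<longrightarrow> block_min A r (fst u)) \<and> (hi i \<longrightarrow> block_max A r (snd u))"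
    by fastforce
  from bchoice[OF this] obtain u where "\<forall>i\<in>{..<k}. near A r (g i) (fst (u i)) \<and> near A r (g i) (snd (u i)) \<and>
      (fst (u i) = snd (u i) \<or> fst (u i) \<sqsubset> snd (u i)) \<and>
      (lo i \<longrightarrow> block_min A r (fst (u i))) \<and> (hi i \<longrightarrow> block_max A r (snd (u i)))"
    by blast
  moreover define p q where "p i = fst (u i)" and "q i = snd (u i)" for i
  ultimately have pq: "\<And>i. i < k \<Longrightarrow> near A r (g i) (p i)" "\<And>i. i < k \<Longrightarrow> near A r (g i) (q i)"
    "\<And>i. i < k \<Longrightarrow> p i = q i \<or> p i \<sqsubset> q i"
    "\<And>i. i < k \<Longrightarrow> lo i \<Longrightarrow> block_min A r (p i)" "\<And>i. i < k \<Longrightarrow> hi i \<Longrightarrow> block_max A r (q i)"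
    by simp_all
  have "\<exists>n c. c 0 = p i \<and> c n = q i \<and> (\<forall>j\<le>n. c j \<in> A) \<and>
      (\<forall>j<n. c j \<sqsubset> c (Suc j) \<and> btw (c j) (c (Suc j)) = {})" if "i < k" for i
    using consecutive_chain[OF near_trans[OF near_sym[OF pq(1)[OF that]] pq(2)[OF that]] pq(3)[OF that]] .
  then have "\<forall>i\<in>{..<k}. \<exists>n c. c 0 = p i \<and> c n = q i \<and> (\<forall>j\<le>n. c j \<in> A) \<and>
      (\<forall>j<n. c j \<sqsubset> c (Suc j) \<and> btw (c j) (c (Suc j)) = {})"
    by simp
  from bchoice[OF this] obtain n where "\<forall>i\<in>{..<k}. \<exists>c. c 0 = p i \<and> c (n i) = q i \<and> (\<forall>j\<le>n i. c j \<in> A) \<and>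
      (\<forall>j<n i. c j \<sqsubset> c (Suc j) \<and> btw (c j) (c (Suc j)) = {})"
    by blast
  from bchoice[OF this] obtain a where "\<forall>i\<in>{..<k}. a i 0 = p i \<and> a i (n i) = q i \<and> (\<forall>j\<le>n i. a i j \<in> A) \<and>
      (\<forall>j<n i. a i j \<sqsubset> a i (Suc j) \<and> btw (a i j) (a i (Suc j)) = {})"
    by blast
  then have na: "\<And>i. i < k \<Longrightarrow> a i 0 = p i" "\<And>i. i < k \<Longrightarrow> a i (n i) = q i"
    "\<And>i. i < k \<Longrightarrow> \<forall>j\<le>n i. a i j \<in> A"
    "\<And>i. i < k \<Longrightarrow> \<forall>j<n i. a i j \<sqsubset> a i (Suc j) \<and> btw (a i j) (a i (Suc j)) = {}"
    by simp_all
  have "infinite (btw (a i 0) (a (Suc i) 0))" if "Suc i < k" for i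
  proof -
    have i: "i < k" using that by simp
    have nf: "\<not> near A r (g i) (g (Suc i))" using far[of i "Suc i"] that by simp
    have lt: "p i \<sqsubset> p (Suc i)"
      using far_less[OF g(2)[OF lessI that] nf pq(1)[OF i] pq(1)[OF that]] .
    have "\<not> near A r (p i) (p (Suc i))"
    proof
      assume n: "near A r (p i) (p (Suc i))"
      show False
        using nf near_trans[OF near_trans[OF pq(1)[OF i] n] near_sym[OF pq(1)[OF that]]] by blast
    qed
    then show ?thesis using near_iff_finite[OF lt] na(1)[OF i] na(1)[OF that] by simp
  qed
  then have "shape_witness A r k n lo hi a"
    unfolding shape_witness_def using na pq(4,5) by simp
  moreover have "at_most_blocks A r k"
    unfolding at_most_blocks_def
  proof (intro allI impI, rule ccontr)
    fix y assume y: "\<forall>i\<le>k. y i \<in> A"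
      and contra: "\<not> (\<exists>i\<le>k. \<exists>j\<le>k. i \<noteq> j \<and> (y i, y j) \<in> r \<and> finite (btw (y i) (y j)))"
    have nn: "\<not> near A r (y i) (y j) \<and> y i \<noteq> y j" if "i \<le> k" "j \<le> k" "i \<noteq> j" for i j
    proof -
      have "\<not> ((y i, y j) \<in> r \<and> finite (btw (y i) (y j)))" "\<not> ((y j, y i) \<in> r \<and> finite (btw (y j) (y i)))"
        using contra that by blast+
      moreover have "y i \<in> A" "y j \<in> A" using y that by blast+
      ultimately show ?thesis using lt_total[of "y i" "y j"] by (auto simp: near_def rel_iff)
    qed
    \<comment> \<open>These would be \<open>k + 1\<close> pairwise distant elements, more than the
      largest size \<open>k\<close>.\<close>
    then have inj: "inj_on y {..k}" unfolding inj_on_def by blast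
    have "?P (y ` {..k})"
      using y nn by (auto simp: pairwise_def)
    then have "card (y ` {..k}) \<le> k" using maximal by (simp add: k_def)
    then show False using card_image[OF inj] by simp
  qed
  moreover have "at_most_points A (block_min A r) (card {i. i < k \<and> lo i})"
  proof -
    have fin: "finite {i. i < k \<and> lo i}" by simp
    have sub: "{x\<in>A. block_min A r x} \<subseteq> p ` {i. i < k \<and> lo i}"
    proof
      fix x assume "x \<in> {x\<in>A. block_min A r x}"
      then have x: "x \<in> A" "block_min A r x" by simp_all
      obtain i where i: "i < k" "near A r (g i) x" using cover[OF x(1)] by blast
      then have "lo i" using x(2) by (auto simp: lo_def)
      have n: "near A r x (p i)" using near_trans[OF near_sym[OF i(2)] pq(1)[OF i(1)]] .
      have "x = p i"
        using block_min_near[OF x(2) n] block_min_near[OF pq(4)[OF i(1) \<open>lo i\<close>] near_sym[OF n]]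
          lt_asym[of x "p i"] by blast
      then show "x \<in> p ` {i. i < k \<and> lo i}" using i \<open>lo i\<close> by blast
    qed
    show ?thesis
      unfolding at_most_points_iff using finite_surj[OF fin sub] surj_card_le[OF fin sub] by blast
  qed
  moreover have "at_most_points A (block_max A r) (card {i. i < k \<and> hi i})"
  proof -
    have fin: "finite {i. i < k \<and> hi i}" by simp
    have sub: "{x\<in>A. block_max A r x} \<subseteq> q ` {i. i < k \<and> hi i}"
    proof
      fix x assume "x \<in> {x\<in>A. block_max A r x}"
      then have x: "x \<in> A" "block_max A r x" by simp_all
      obtain i where i: "i < k" "near A r (g i) x" using cover[OF x(1)] by blast
      then have "hi i" using x(2) by (auto simp: hi_def)
      have n: "near A r x (q i)" using near_trans[OF near_sym[OF i(2)] pq(2)[OF i(1)]] .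
      have "x = q i"
        using block_max_near[OF x(2) n] block_max_near[OF pq(5)[OF i(1) \<open>hi i\<close>] near_sym[OF n]]
          lt_asym[of x "q i"] by blast
      then show "x \<in> q ` {i. i < k \<and> hi i}" using i \<open>hi i\<close> by blast
    qed
    show ?thesis
      unfolding at_most_points_iff using finite_surj[OF fin sub] surj_card_le[OF fin sub] by blast
  qed
  ultimately have "has_shape A r k n lo hi"
    unfolding has_shape_def by (intro conjI exI[of _ a])
  then show ?thesis by blast
qed

end

section \<open>Hausdorff rank 1 implies few blocks\<close>

lemma HR_0_finite: "HR 0 A r \<Longrightarrow> finite A"
  by (erule HR.cases) simp_all

lemma is_ordered_sumD:
  assumes "is_ordered_sum I P A r"
  shows "linear_order_on A r" "A = (\<Union>i\<in>I. P i)"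
    "\<And>i j x y. i \<in> I \<Longrightarrow> j \<in> I \<Longrightarrow> i < j \<Longrightarrow> x \<in> P i \<Longrightarrow> y \<in> P j \<Longrightarrow> less_in r x y"
  using assms unfolding is_ordered_sum_def less_in_def by blast+

lemma between_pieces:
  assumes "is_ordered_sum I P A r" "i \<in> I" "j \<in> I" "x \<in> P i" "y \<in> P j" "z \<in> between A r x y"
  shows "\<exists>l\<in>I. i \<le> l \<and> l \<le> j \<and> z \<in> P l"
proof -
  interpret linear_order_set A r by unfold_locales (rule is_ordered_sumD(1)[OF assms(1)])
  have z: "z \<in> A" "x \<sqsubset> z" "z \<sqsubset> y" using assms(6) by (simp_all add: between_def)
  then obtain l where l: "l \<in> I" "z \<in> P l" using is_ordered_sumD(2)[OF assms(1)] by blast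
  have "i \<le> l"
    using is_ordered_sumD(3)[OF assms(1) l(1) assms(2) _ l(2) assms(4)] lt_asym[OF z(2)] by (meson not_le)
  moreover have "l \<le> j"
    using is_ordered_sumD(3)[OF assms(1) assms(3) l(1) _ assms(5) l(2)] lt_asym[OF z(3)] by (meson not_le)
  ultimately show ?thesis using l by blast
qed

text \<open>Only finitely many integers lie between two indices, so every interval is covered by
  finitely many finite pieces. All elements are therefore near each other.\<close>

lemma few_blocks_zeta_sum:
  assumes sum: "is_ordered_sum (UNIV :: int set) P A r" and fin: "\<forall>i. finite (P i)"
  shows "few_blocks A r 1"
proof -
  have fb: "finite (between A r x y)" if xy: "x \<in> A" "y \<in> A" for x y
  proof -
    obtain i j where ij: "x \<in> P i" "y \<in> P j" using xy is_ordered_sumD(2)[OF sum] by blast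
    have "between A r x y \<subseteq> (\<Union>l\<in>{i..j}. P l)"
      using between_pieces[OF sum UNIV_I UNIV_I ij] by fastforce
    then show ?thesis using fin by (meson finite_UN_I finite_atLeastAtMost_int finite_subset)
  qed
  show ?thesis
    unfolding few_blocks_def
  proof (intro allI impI)
    fix S assume S: "S \<subseteq> A" "finite S" "pairwise (\<lambda>x y. \<not> near A r x y) S"
    have "near A r x y" if "x \<in> S" "y \<in> S" for x y
      using fb that S(1) by (auto simp: near_def)
    then have "\<forall>x\<in>S. \<forall>y\<in>S. x = y" using S(3) by (auto simp: pairwise_def)
    then show "card S \<le> 1" using card_le_Suc0_iff_eq[OF S(2)] by simp
  qed
qed

text \<open>The summands are convex, so elements near in a summand are near in the sum, and each
  summand contributes at most \<open>N i\<close> pairwise distant elements. Blocks of neighbouring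
  summands may merge, which only lowers the number.\<close>

lemma few_blocks_finite_sum:
  assumes sum: "is_ordered_sum {..<k::nat} P A r"
    and few: "\<forall>i<k. few_blocks (P i) (Restr r (P i)) (N i)"
  shows "few_blocks A r (\<Sum>i<k. N i)"
  unfolding few_blocks_def
proof (intro allI impI)
  fix S assume S: "S \<subseteq> A" "finite S" "pairwise (\<lambda>x y. \<not> near A r x y) S"
  have "card (S \<inter> P i) \<le> N i" if i: "i < k" for i
  proof -
    have "near A r x y" if "near (P i) (Restr r (P i)) x y" for x y
    proof -
      have xy: "x \<in> P i" "y \<in> P i" using that by (simp_all add: near_def)
      have "between A r u v \<subseteq> between (P i) (Restr r (P i)) u v" if "u \<in> P i" "v \<in> P i" for u v
      proof
        fix z assume z: "z \<in> between A r u v"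
        have "z \<in> P i" using between_pieces[OF sum _ _ that z] i by auto
        then show "z \<in> between (P i) (Restr r (P i)) u v"
          using z that by (simp add: between_def less_in_def)
      qed
      then have "finite (between A r x y)" "finite (between A r y x)"
        using xy that by (meson finite_subset near_def)+
      moreover have "P i \<subseteq> A" using is_ordered_sumD(2)[OF sum] i by blast
      ultimately show ?thesis using xy by (auto simp: near_def)
    qed
    then have "pairwise (\<lambda>x y. \<not> near (P i) (Restr r (P i)) x y) (S \<inter> P i)"
      using S(3) unfolding pairwise_def by blast
    then show ?thesis using few i S(2) by (simp add: few_blocks_def)
  qed
  then have "(\<Sum>i<k. card (S \<inter> P i)) \<le> (\<Sum>i<k. N i)" by (intro sum_mono) simp
  moreover have "S = (\<Union>i<k. S \<inter> P i)" using S(1) is_ordered_sumD(2)[OF sum] by blast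
  then have "card S \<le> (\<Sum>i<k. card (S \<inter> P i))" using card_UN_le[of "{..<k}" "\<lambda>i. S \<inter> P i"] by simp
  ultimately show "card S \<le> (\<Sum>i<k. N i)" by linarith
qed

lemma HR_1_few_blocks: "HR \<alpha> A r \<Longrightarrow> \<alpha> = 1 \<Longrightarrow> \<exists>N. few_blocks A r N"
proof (induction rule: HR.induct)
  case (HR_zeta_sum \<alpha> P A r)
  then have "\<forall>i. finite (P i)" using HR_0_finite by (metis less_one)
  then show ?case using few_blocks_zeta_sum[OF HR_zeta_sum.hyps(2)] by blast
next
  case (HR_finite_sum \<alpha> k P A r)
  then have "\<forall>i. \<exists>N. i < k \<longrightarrow> few_blocks (P i) (Restr r (P i)) N" by blast
  then obtain N where "\<forall>i<k. few_blocks (P i) (Restr r (P i)) (N i)" by metis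
  then show ?case using few_blocks_finite_sum[OF HR_finite_sum.hyps(2)] by blast
qed simp

theorem theorem2p6:
  fixes A :: "'a set" and r :: "'a rel"
  assumes "linear_order_on A r"
    and "countable A"
    and "has_hausdorff_rank A r 1"
  shows "\<exists>\<phi>. computable_fm \<phi> \<and> is_d_Sigma 3 \<phi> \<and> scott_sentence A r \<phi>"
proof -
  interpret A: linear_order_set A r by unfold_locales (rule assms(1))
  have "HR 1 A r" "\<not> HR 0 A r" using assms(3) by (simp_all add: has_hausdorff_rank_def)
  \<comment> \<open>The empty order has rank 0. Nonemptiness matters because the sentence to be
    built has no empty model.\<close>
  then have "A \<noteq> {}" using HR_0[OF assms(1)] by auto
  obtain k n lo hi where shape: "has_shape A r k n lo hi"
    using HR_1_few_blocks[OF \<open>HR 1 A r\<close> refl] A.has_shape_exists by blast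
  have "finite (\<Union>i<k. var i ` {..n i})" by simp
  then obtain K where K: "\<forall>v\<in>(\<Union>i<k. var i ` {..n i}). v < K"
    using finite_nat_set_iff_bounded by blast
  \<comment> \<open>Passing to \<open>Suc K\<close> guarantees at least one existentially quantified
    variable, even if the bound \<open>K\<close> happens to be 0.\<close>
  then have vars: "0 < Suc K" "\<forall>i<k. \<forall>j\<le>n i. var i j < Suc K" by (auto simp: less_SucI)
  define J where "J = bound_clauses k (card {i. i < k \<and> lo i}) (card {i. i < k \<and> hi i})"
  define \<phi> where "\<phi> = clauses_fm (Suc K) (witness_clauses (Suc K) k n lo hi) J"
  note over = witness_clauses_over[OF vars, of lo hi]
    bound_clauses_over[of k "card {i. i < k \<and> lo i}" "card {i. i < k \<and> hi i}", folded J_def]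
  have "computable_fm \<phi>" "is_d_Sigma 3 \<phi>" "sentence \<phi>"
    unfolding \<phi>_def using computable_clauses_fm[OF over] is_d_Sigma_clauses_fm[OF over]
      sentence_clauses_fm[OF over] by blast+
  \<comment> \<open>Stated for an arbitrary carrier type, since it is applied both to
    \<open>A\<close> and to sets of natural numbers.\<close>
  have models: "models B s \<phi> \<longleftrightarrow> B \<noteq> {} \<and> has_shape B s k n lo hi"
    if "linear_order_on B s" for B :: "'b set" and s
  proof -
    interpret B: linear_order_set B s by unfold_locales (rule that)
    show ?thesis
      using B.models_shape[OF vars] unfolding \<phi>_def J_def has_shape_def by blast
  qed
  have iso: "isomorphic B s (shape_carrier k n lo hi) lex_order"
    if "linear_order_on B s" "has_shape B s k n lo hi" for B :: "'b set" and s
  proof -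
    interpret B: linear_order_set B s by unfold_locales (rule that(1))
    show ?thesis using B.isomorphic_shape[OF that(2)] .
  qed
  have "models A r \<phi>" using models[OF assms(1)] shape \<open>A \<noteq> {}\<close> by blast
  have "models B s \<phi> \<longleftrightarrow> isomorphic A r B s" if "s \<subseteq> B \<times> B" for B :: "nat set" and s
  proof
    assume "isomorphic A r B s"
    then show "models B s \<phi>" using models_iso[OF \<open>sentence \<phi>\<close>] \<open>models A r \<phi>\<close> by blast
  next
    assume m: "models B s \<phi>"
    have "(3, {linear_order_clause}) \<in> J" by (simp add: J_def bound_clauses_def)
    \<comment> \<open>Linearity has to come first, as the reading of the sentence in terms of shapes
      presupposes it.\<close>
    then have lin: "linear_order_on B s"
      using linear_order_if_models[OF that m[unfolded \<phi>_def]] over(4) by blast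
    then have "isomorphic B s (shape_carrier k n lo hi) lex_order"
      using iso models m by blast
    then show "isomorphic A r B s"
      using isomorphic_trans[OF iso[OF assms(1) shape] isomorphic_sym] by blast
  qed
  then have "scott_sentence A r \<phi>" using \<open>sentence \<phi>\<close> by (simp add: scott_sentence_def)
  then show ?thesis using \<open>computable_fm \<phi>\<close> \<open>is_d_Sigma 3 \<phi>\<close> by blast
qed

end
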